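(* For any $\epsilon>0$ and $\rho\in(0,1)$, there exist infinitely many positive integers $d$ such that, for a suitable constant $c$ (depending on $\epsilon,\rho,d$), a random bipartite graph $G$ on $[N]\cup[M]$ with $M=cN$ that is $d$-regular in $[M]$ satisfies the following two properties with high probability: (1) $G$ is a $\big(\rho N,(1-(1-\rho)^d-\epsilon)M\big)$-disperser; (2) the objective value of the $\Omega(N)$-level Lasserre hierarchy for the vertex expansion of $\rho N$-subsets of $G$ is at most $\big(1-C_0\cdot\frac{1-\rho}{d\rho+1-\rho}\big)M$, for a universal constant $C_0\ge 1/10$.
   Context: A bipartite graph $G=([N],[M],E)$ is a $(k,s)$-disperser if every $S\subseteq[N]$ with $|S|=k$ has $|\Gamma(S)|\ge s$, where $\Gamma(S)$ is the neighbor set. Random bipartite graph $d$-regular in $[M]$: each $j\in[M]$ independently is connected to $d$ vertices of $[N]$ chosen independently and uniformly at random. "With high probability": probability tending to $1$ as $N\to\infty$. Lasserre relaxation: for $G=([N],[M],E)$, $\rho\in(0,1)$ and integer $t\ge1$, the $t$-level Lasserre relaxation for the vertex expansion of $\rho N$-subsets has real variables $y_S(f)$ for all $S\subseteq[N]$ of size at most $2t+\max(1,\max_j|\Gamma(j)|)$ and $f\in\{0,1\}^S$, with $y_\emptyset=1$ and $y_{S\cup T}(f\circ g):=0$ if $f,g$ disagree on $S\cap T$ ($f\circ g$ the combined assignment). Constraints: (i) the matrix indexed by $(S,f)$, $|S|\le t$, with entries $y_{S\cup T}(f\circ g)$ is positive semidefinite; (ii) the matrix with entries $\sum_{i=1}^N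 y_{S\cup T\cup\{i\}}(f\circ g\circ 1_i)-\rho N\,y_{S\cup T}(f\circ g)$ ($1_i$ assigns $1$ to $i$) is positive semidefinite. Objective: minimize $\sum_{j\in[M]}(1-y_{\Gamma(j)}(\vec 0))$. The objective value of the $t$-level Lasserre hierarchy is the optimum of this program. "$\Omega(N)$-level" means level $t=\lfloor c'N\rfloor$ for some constant $c'>0$ independent of $N$. *)

theory Defs
  imports "HOL-Probability.Probability"
begin

text \<open>
  A bipartite graph \<open>([N], [M], E)\<close> is given by \<open>N\<close>, \<open>M\<close> and its edge set, with left vertices
  \<open>{1..N}\<close> and right vertices \<open>{1..M}\<close>; the two sides are told apart by the position in the pair.
\<close>

definition bipartite_graph :: "nat \<Rightarrow> nat \<Rightarrow> (nat \<times> nat) set \<Rightarrow> bool" where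
  "bipartite_graph N M E \<longleftrightarrow> E \<subseteq> {1..N} \<times> {1..M}"

definition nbrs_left :: "(nat \<times> nat) set \<Rightarrow> nat set \<Rightarrow> nat set" where
  "nbrs_left E S = {j. \<exists>i\<in>S. (i, j) \<in> E}"

definition nbrs_right :: "(nat \<times> nat) set \<Rightarrow> nat \<Rightarrow> nat set" where
  "nbrs_right E j = {i. (i, j) \<in> E}"

definition disperser :: "nat \<Rightarrow> nat \<Rightarrow> (nat \<times> nat) set \<Rightarrow> nat \<Rightarrow> real \<Rightarrow> bool" where
  "disperser N M E k s \<longleftrightarrow>
     bipartite_graph N M E \<and>
     (\<forall>S. S \<subseteq> {1..N} \<and> card S = k \<longrightarrow> s \<le> real (card (nbrs_left E S)))"

text \<open>
  The \<open>l\<close>-th choice of the right vertex \<open>j\<close> is the value at \<open>(j, l)\<close>. All choices are independent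
  and uniform, so a vertex may be chosen repeatedly and \<open>j\<close> has at most \<open>d\<close> distinct neighbours.
\<close>

definition random_bipartite :: "nat \<Rightarrow> nat \<Rightarrow> nat \<Rightarrow> (nat \<times> nat) set pmf" where
  "random_bipartite N M d =
     map_pmf (\<lambda>h. {(h (j, l), j) | j l. j \<in> {1..M} \<and> l \<in> {1..d}})
       (Pi_pmf ({1..M} \<times> {1..d}) 0 (\<lambda>_. pmf_of_set {1..N}))"

text \<open>
  A pair \<open>(S, f)\<close> with \<open>f \<in> {0,1}\<^sup>S\<close> is encoded as a partial map with domain \<open>S\<close> (\<open>False\<close> for \<open>0\<close>,
  \<open>True\<close> for \<open>1\<close>), so that \<open>y\<^sub>S(f)\<close> becomes \<open>y f\<close>. The variables are a total function on partial
  maps, but only its values on domains of size at most \<open>2t + max 1 (max\<^sub>j |\<Gamma>(j)|)\<close> are ever used.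
\<close>

type_synonym passign = "nat \<rightharpoonup> bool"

definition agree :: "passign \<Rightarrow> passign \<Rightarrow> bool" where
  "agree f g \<longleftrightarrow> (\<forall>i \<in> dom f \<inter> dom g. f i = g i)"

definition y2 :: "(passign \<Rightarrow> real) \<Rightarrow> passign \<Rightarrow> passign \<Rightarrow> real" where
  "y2 y f g = (if agree f g then y (f ++ g) else 0)"

definition y3 :: "(passign \<Rightarrow> real) \<Rightarrow> passign \<Rightarrow> passign \<Rightarrow> passign \<Rightarrow> real" where
  "y3 y f g h = (if agree f g then y2 y (f ++ g) h else 0)"

definition passigns :: "nat \<Rightarrow> nat \<Rightarrow> passign set" where
  "passigns N t = {f. dom f \<subseteq> {1..N} \<and> card (dom f) \<le> t}"

definition psd_on :: "'a set \<Rightarrow> ('a \<Rightarrow> 'a \<Rightarrow> real) \<Rightarrow> bool" where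
  "psd_on I A \<longleftrightarrow>
     (\<forall>a\<in>I. \<forall>b\<in>I. A a b = A b a) \<and>
     (\<forall>x :: 'a \<Rightarrow> real. 0 \<le> (\<Sum>a\<in>I. \<Sum>b\<in>I. x a * A a b * x b))"

definition lasserre_feasible :: "nat \<Rightarrow> real \<Rightarrow> nat \<Rightarrow> (passign \<Rightarrow> real) \<Rightarrow> bool" where
  "lasserre_feasible N \<rho> t y \<longleftrightarrow>
     y Map.empty = 1 \<and>
     psd_on (passigns N t) (y2 y) \<and>
     psd_on (passigns N t)
       (\<lambda>f g. (\<Sum>i = 1..N. y3 y f g [i \<mapsto> True]) - \<rho> * real N * y2 y f g)"

definition lasserre_objective :: "nat \<Rightarrow> (nat \<times> nat) set \<Rightarrow> (passign \<Rightarrow> real) \<Rightarrow> real" where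
  "lasserre_objective M E y =
     (\<Sum>j = 1..M. 1 - y ((\<lambda>_. Some False) |` nbrs_right E j))"

text \<open>
  Taken in \<open>ereal\<close>, since for \<open>2t\<close> smaller than some \<open>|\<Gamma>(j)|\<close> the objective can be unbounded below.
\<close>

definition lasserre_value :: "nat \<Rightarrow> nat \<Rightarrow> (nat \<times> nat) set \<Rightarrow> real \<Rightarrow> nat \<Rightarrow> ereal" where
  "lasserre_value N M E \<rho> t =
     (INF y \<in> {y. lasserre_feasible N \<rho> t y}. ereal (lasserre_objective M E y))"

end

theory Submission
  imports Defs "HOL-Number_Theory.Cong"
begin

text \<open>
  Take a large prime \<open>p\<close>, an integer \<open>a\<close> close to \<open>(1 + \<rho>)/2 * p\<close> and \<open>d\<close> close to \<open>a / (2\<rho>)\<close>; then \<open>M = N\<close>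
  suffices.

  For the Lasserre solution, cut the first \<open>n * p\<close> left vertices, \<open>n \<approx> \<rho>N / a\<close>, into blocks of \<open>p\<close> consecutive
  vertices with one variable \<open>x\<^sub>b \<in> \<int>/p\<close> per block, and put vertex \<open>i\<close> of block \<open>b\<close> into the set iff
  \<open>x\<^sub>b + i\<close> has a residue below \<open>a\<close>; the other vertices stay out. For every \<open>x\<close> the set has exactly \<open>n * a \<ge> \<rho>N\<close>
  elements, so the localizing matrix is a nonnegative multiple of the moment matrix. A typical right vertex
  meets at most \<open>p\<close> blocks, each once, and the constraint imposed on it is that the values \<open>x\<^sub>b + i\<close> at its
  neighbours form a word of a Reed-Solomon code of dimension 2. The constant words show that the right vertex
  is missed by the set with probability at least \<open>(p - a)/p\<^sup>2\<close>.

  The dual code has distance 3, whereas any \<open>s \<le> \<alpha>N\<close> right vertices meet at least \<open>(d - 1.1) s\<close> blocks. Hence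
  the sum of equations from \<open>s\<close> different constraints has support at least \<open>0.8 s\<close>. The pseudo-expectation that
  sends a character to its derived value, if it is derivable from few constraints, and to 0 otherwise is
  therefore well defined, and it is positive because derivability of the quotient is an equivalence
  relation on characters of low degree (Schoenebeck, Tulsiani). Right vertices with repeated or too many
  blocks, and those sharing two blocks with another one, are few; their constraints are dropped.

  The disperser property needs no concentration
  inequality: since \<open>d\<close> may be large, the trivial bound \<open>2^N * 2^M * (1 - \<rho>/2)^(d \<epsilon> M)\<close> is small enough.
\<close>

lemma excess_mono:
  assumes "finite K" and "\<And>j. j \<in> K \<Longrightarrow> finite (S j)" and "\<And>j. j \<in> K \<Longrightarrow> T j \<subseteq> S j"
  shows "(\<Sum>j\<in>K. card (T j)) + card (\<Union>j\<in>K. S j) \<le> (\<Sum>j\<in>K. card (S j)) + card (\<Union>j\<in>K. T j)"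
proof -
  have fin: "finite (T j)" if "j \<in> K" for j
    using assms that finite_subset by blast
  have "card (\<Union>j\<in>K. S j) \<le> card ((\<Union>j\<in>K. T j) \<union> (\<Union>j\<in>K. S j - T j))"
    using assms fin by (intro card_mono) auto
  also have "\<dots> \<le> card (\<Union>j\<in>K. T j) + card (\<Union>j\<in>K. S j - T j)"
    by (rule card_Un_le)
  also have "card (\<Union>j\<in>K. S j - T j) \<le> (\<Sum>j\<in>K. card (S j - T j))"
    using assms by (intro card_UN_le) auto
  also have "(\<Sum>j\<in>K. card (S j - T j)) = (\<Sum>j\<in>K. card (S j)) - (\<Sum>j\<in>K. card (T j))"
    using assms fin by (subst sum_subtractf_nat [symmetric]) (auto simp: card_Diff_subset intro!: sum.cong card_mono)
  finally show ?thesis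
    using sum_mono[of K "\<lambda>j. card (T j)" "\<lambda>j. card (S j)"] assms by (auto simp: card_mono)
qed

lemma sum_card_Int_eq:
  assumes "finite K" "finite U"
  shows "(\<Sum>j\<in>K. card (T j \<inter> U)) = (\<Sum>b\<in>U. card {j\<in>K. b \<in> T j})"
proof -
  have "(\<Sum>j\<in>K. card (T j \<inter> U)) = (\<Sum>j\<in>K. \<Sum>b\<in>U. of_bool (b \<in> T j))"
    using assms by (intro sum.cong refl) (simp add: Int_def conj_commute)
  also have "\<dots> = (\<Sum>b\<in>U. \<Sum>j\<in>K. of_bool (b \<in> T j))"
    by (rule sum.swap)
  also have "\<dots> = (\<Sum>b\<in>U. card {j\<in>K. b \<in> T j})"
    using assms by (intro sum.cong refl) (simp add: Int_def)
  finally show ?thesis .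
qed

lemma not_dvd_sum_if_unique:
  fixes f :: "'a \<Rightarrow> int"
  assumes "finite J" "card {j\<in>J. \<not> q dvd f j} = 1"
  shows "\<not> q dvd (\<Sum>j\<in>J. f j)"
proof -
  obtain j0 where j0: "{j\<in>J. \<not> q dvd f j} = {j0}"
    using assms(2) by (auto simp: card_1_singleton_iff)
  then have "j0 \<in> J" "\<not> q dvd f j0" by auto
  moreover have "q dvd (\<Sum>j\<in>J - {j0}. f j)"
    using j0 by (intro dvd_sum) auto
  ultimately show ?thesis
    using assms(1) by (simp add: sum.remove dvd_add_left_iff)
qed

section \<open>Fourier analysis modulo p\<close>

definition root_char :: "nat \<Rightarrow> int \<Rightarrow> complex" where
  "root_char p k = cis (2 * pi * of_int k / of_nat p)"

lemma root_char_add: "root_char p (k + l) = root_char p k * root_char p l"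
  by (simp add: root_char_def cis_mult add_divide_distrib ring_distribs)

lemma root_char_0 [simp]: "root_char p 0 = 1"
  by (simp add: root_char_def)

lemma root_char_uminus: "root_char p (- k) = cnj (root_char p k)"
  by (simp add: root_char_def cis_cnj)

lemma root_char_diff: "root_char p (k - l) = root_char p k * cnj (root_char p l)"
  using root_char_add[of p k "- l"] by (simp add: root_char_uminus)

lemma root_char_sum: "finite A \<Longrightarrow> root_char p (\<Sum>b\<in>A. f b) = (\<Prod>b\<in>A. root_char p (f b))"
  by (induction A rule: finite_induct) (auto simp: root_char_add)

lemma root_char_eq_1_iff:
  assumes "p > 0"
  shows "root_char p k = 1 \<longleftrightarrow> int p dvd k"
proof
  assume "root_char p k = 1"
  then have "cos (2 * pi * of_int k / of_nat p) = 1"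
    by (simp add: root_char_def complex_eq_iff)
  then obtain m :: int where "2 * pi * of_int k / of_nat p = of_int m * 2 * pi"
    using cos_one_2pi_int by auto
  then have "real_of_int k = of_int (m * int p)"
    using assms by (simp add: field_simps)
  then have "k = m * int p"
    by (simp only: of_int_eq_iff)
  then show "int p dvd k" by simp
next
  assume "int p dvd k"
  then obtain m where "k = int p * m" ..
  then have "2 * pi * of_int k / of_nat p = 2 * pi * of_int m"
    using assms by simp
  then show "root_char p k = 1"
    by (simp add: root_char_def cis_multiple_2pi)
qed

lemma root_char_cong:
  assumes "p > 0" "[k = l] (mod int p)"
  shows "root_char p k = root_char p l"
proof -
  have "root_char p (k - l) = 1"
    using assms by (simp add: root_char_eq_1_iff cong_iff_dvd_diff)
  then show ?thesis
    using root_char_add[of p "k - l" l] by simp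
qed

lemma sum_root_char:
  assumes "p > 0"
  shows "(\<Sum>x\<in>{0..<int p}. root_char p (k * x)) = (if int p dvd k then of_nat p else 0)"
proof (cases "int p dvd k")
  case True
  then have "root_char p (k * x) = 1" for x
    using assms by (subst root_char_eq_1_iff) auto
  then show ?thesis using True by simp
next
  case False
  define z where "z = root_char p k"
  have z: "z \<noteq> 1" using False assms by (simp add: z_def root_char_eq_1_iff)
  have pw: "root_char p (k * int m) = z ^ m" for m
    by (induction m) (auto simp: z_def root_char_add ring_distribs mult.commute)
  have "(\<Sum>x\<in>{0..<int p}. root_char p (k * x)) = (\<Sum>m<p. root_char p (k * int m))"
    by (intro sum.reindex_bij_witness[of _ int nat]) auto
  also have "\<dots> = (\<Sum>m<p. z ^ m)" by (simp add: pw)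
  also have "\<dots> = (z ^ p - 1) / (z - 1)" using z by (simp add: geometric_sum)
  also have "z ^ p = 1"
    using assms by (subst pw [symmetric], subst root_char_eq_1_iff) auto
  finally show ?thesis using False by simp
qed

lemma sum_root_char_PiE:
  assumes "p > 0" "finite T"
  shows "(\<Sum>x\<in>PiE T (\<lambda>_. {0..<int p}). root_char p (\<Sum>b\<in>T. \<theta> b * x b))
       = (if \<forall>b\<in>T. int p dvd \<theta> b then of_nat p ^ card T else 0)"
proof -
  have "(\<Sum>x\<in>PiE T (\<lambda>_. {0..<int p}). root_char p (\<Sum>b\<in>T. \<theta> b * x b))
      = (\<Sum>x\<in>PiE T (\<lambda>_. {0..<int p}). \<Prod>b\<in>T. root_char p (\<theta> b * x b))"
    using assms by (simp add: root_char_sum)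
  also have "\<dots> = (\<Prod>b\<in>T. \<Sum>x\<in>{0..<int p}. root_char p (\<theta> b * x))"
    using assms by (subst prod_sum_PiE) auto
  also have "\<dots> = (\<Prod>b\<in>T. if int p dvd \<theta> b then of_nat p else 0)"
    using assms by (simp add: sum_root_char)
  also have "\<dots> = (if \<forall>b\<in>T. int p dvd \<theta> b then of_nat p ^ card T else 0)"
    using assms by (auto intro!: prod_zero)
  finally show ?thesis .
qed

lemma junta_expansion:
  fixes F :: "('a \<Rightarrow> int) \<Rightarrow> complex"
  assumes "p > 0" "finite T"
  obtains c where "\<And>x. x \<in> T \<rightarrow> {0..<int p} \<Longrightarrow> F (restrict x T) = F x \<Longrightarrow>
    F x = (\<Sum>\<kappa>\<in>PiE T (\<lambda>_. {0..<int p}). c \<kappa> * root_char p (\<Sum>b\<in>T. \<kappa> b * x b))"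
proof
  let ?X = "PiE T (\<lambda>_. {0..<int p})"
  define c where "c = (\<lambda>\<kappa>. (\<Sum>\<mu>\<in>?X. F \<mu> * root_char p (- (\<Sum>b\<in>T. \<kappa> b * \<mu> b))) / of_nat p ^ card T)"
  fix x assume x: "x \<in> T \<rightarrow> {0..<int p}" and F: "F (restrict x T) = F x"
  have finX: "finite ?X" using assms by (intro finite_PiE) auto
  have in_iff: "(\<forall>b\<in>T. int p dvd x b - \<mu> b) \<longleftrightarrow> \<mu> = restrict x T" if "\<mu> \<in> ?X" for \<mu>
  proof
    assume *: "\<forall>b\<in>T. int p dvd x b - \<mu> b"
    show "\<mu> = restrict x T"
    proof
      fix b show "\<mu> b = restrict x T b"
      proof (cases "b \<in> T")
        case True
        then have "[x b = \<mu> b] (mod int p)" using * by (simp add: cong_iff_dvd_diff)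
        moreover have "x b \<in> {0..<int p}" "\<mu> b \<in> {0..<int p}" using True x that by auto
        ultimately show ?thesis using True by (simp add: cong_def)
      qed (use that in \<open>auto simp: PiE_def extensional_def\<close>)
    qed
  qed auto
  have "(\<Sum>\<kappa>\<in>?X. c \<kappa> * root_char p (\<Sum>b\<in>T. \<kappa> b * x b))
     = (\<Sum>\<kappa>\<in>?X. \<Sum>\<mu>\<in>?X. F \<mu> * root_char p (\<Sum>b\<in>T. (x b - \<mu> b) * \<kappa> b) / of_nat p ^ card T)"
    by (simp add: c_def sum_divide_distrib sum_distrib_left sum_distrib_right sum_subtractf algebra_simps root_char_diff
        root_char_uminus)
  also have "\<dots> = (\<Sum>\<mu>\<in>?X. \<Sum>\<kappa>\<in>?X. F \<mu> * root_char p (\<Sum>b\<in>T. (x b - \<mu> b) * \<kappa> b) / of_nat p ^ card T)"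
    by (rule sum.swap)
  also have "\<dots> = (\<Sum>\<mu>\<in>?X. F \<mu> * (\<Sum>\<kappa>\<in>?X. root_char p (\<Sum>b\<in>T. (x b - \<mu> b) * \<kappa> b)) / of_nat p ^ card T)"
    by (simp add: sum_distrib_left sum_divide_distrib)
  also have "\<dots> = (\<Sum>\<mu>\<in>?X. if \<mu> = restrict x T then F \<mu> else 0)"
  proof (rule sum.cong[OF refl])
    fix \<mu> assume "\<mu> \<in> ?X"
    then show "F \<mu> * (\<Sum>\<kappa>\<in>?X. root_char p (\<Sum>b\<in>T. (x b - \<mu> b) * \<kappa> b)) / of_nat p ^ card T
        = (if \<mu> = restrict x T then F \<mu> else 0)"
      unfolding sum_root_char_PiE[OF assms] in_iff[OF \<open>\<mu> \<in> ?X\<close>] using assms by simp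
  qed
  also have "\<dots> = F (restrict x T)"
  proof -
    have "restrict x T \<in> ?X" using x by auto
    then show ?thesis using finX by (simp only: sum.delta if_True)
  qed
  also have "\<dots> = F x" by (rule F)
  finally show "F x = (\<Sum>\<kappa>\<in>?X. c \<kappa> * root_char p (\<Sum>b\<in>T. \<kappa> b * x b))" ..
qed


section \<open>Pseudo-expectations for expanding affine systems\<close>

text \<open>
  A system of affine constraints over \<open>\<int>/p\<close> in the variables \<open>0, \<dots>, n - 1\<close>: constraint \<open>j\<close> asks that on
  \<open>S j\<close> the assignment has the form \<open>b \<mapsto> s j b + \<alpha> + \<beta> * e j b\<close>. Its consequences are given by the dual
  code \<open>dual j\<close>, whose nonzero elements have weight at least 3.
\<close>

locale affine_system =
  fixes p n t :: nat and J :: "nat set" and S :: "nat \<Rightarrow> nat set" and e s :: "nat \<Rightarrow> nat \<Rightarrow> int"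
  assumes p: "prime p"
    and fin_J: "finite J"
    and S_sub: "\<And>j. j \<in> J \<Longrightarrow> S j \<subseteq> {..<n}"
    and e_range: "\<And>j b. j \<in> J \<Longrightarrow> b \<in> S j \<Longrightarrow> e j b \<in> {0..<int p}"
    and e_inj: "\<And>j. j \<in> J \<Longrightarrow> inj_on (e j) (S j)"
    and few_common: "\<And>i j. i \<in> J \<Longrightarrow> j \<in> J \<Longrightarrow> i \<noteq> j \<Longrightarrow> card (S i \<inter> S j) \<le> 1"
    and expanding: "\<And>K. K \<subseteq> J \<Longrightarrow> card K \<le> 6 * t \<Longrightarrow>
          10 * (\<Sum>j\<in>K. card (S j)) \<le> 10 * card (\<Union>j\<in>K. S j) + 11 * card K"
    and t: "t \<ge> 1"
begin

definition dual :: "nat \<Rightarrow> (nat \<Rightarrow> int) set" where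
  "dual j = {w. (\<forall>b. b \<notin> S j \<longrightarrow> w b = 0) \<and> int p dvd (\<Sum>b\<in>S j. w b) \<and> int p dvd (\<Sum>b\<in>S j. w b * e j b)}"

definition supp :: "(nat \<Rightarrow> int) \<Rightarrow> nat set" where
  "supp w = {b. b < n \<and> \<not> int p dvd w b}"

definition combination :: "(nat \<Rightarrow> nat \<Rightarrow> int) \<Rightarrow> bool" where
  "combination u \<longleftrightarrow> (\<forall>j\<in>J. u j \<in> dual j)"

definition active :: "(nat \<Rightarrow> nat \<Rightarrow> int) \<Rightarrow> nat set" where
  "active u = {j\<in>J. supp (u j) \<noteq> {}}"

definition total :: "(nat \<Rightarrow> nat \<Rightarrow> int) \<Rightarrow> nat \<Rightarrow> int" where
  "total u b = (\<Sum>j\<in>J. u j b)"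

definition rhs :: "(nat \<Rightarrow> nat \<Rightarrow> int) \<Rightarrow> int" where
  "rhs u = (\<Sum>j\<in>J. \<Sum>b\<in>S j. u j b * s j b)"

definition derives :: "(nat \<Rightarrow> nat \<Rightarrow> int) \<Rightarrow> (nat \<Rightarrow> int) \<Rightarrow> bool" where
  "derives u \<psi> \<longleftrightarrow> combination u \<and> (\<forall>b<n. [total u b = \<psi> b] (mod int p))"

lemma p_pos: "p > 0"
  using p by (simp add: prime_gt_0_nat)

lemma fin_S: "j \<in> J \<Longrightarrow> finite (S j)"
  using S_sub finite_subset by blast

lemma finite_supp: "finite (supp w)"
  unfolding supp_def by simp

lemma finite_active: "finite (active u)"
  unfolding active_def using fin_J by simp

lemma supp_dual: "w \<in> dual j \<Longrightarrow> supp w \<subseteq> S j"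
  unfolding supp_def dual_def by auto

lemma dual_diff: "w \<in> dual j \<Longrightarrow> w' \<in> dual j \<Longrightarrow> (\<lambda>b. w b - w' b) \<in> dual j"
  unfolding dual_def by (simp add: sum_subtractf left_diff_distrib)

lemma dual_add: "w \<in> dual j \<Longrightarrow> w' \<in> dual j \<Longrightarrow> (\<lambda>b. w b + w' b) \<in> dual j"
  unfolding dual_def by (simp add: sum.distrib distrib_right)

lemma zero_dual: "(\<lambda>_. 0) \<in> dual j"
  unfolding dual_def by simp

lemma dual_weight:
  assumes "j \<in> J" "w \<in> dual j" "supp w \<noteq> {}"
  shows "card (supp w) \<ge> 3"
proof (rule ccontr)
  assume "\<not> card (supp w) \<ge> 3"
  moreover have "card (supp w) \<noteq> 0" using assms finite_supp by simp
  ultimately have "card (supp w) = 1 \<or> card (supp w) = 2" by linarith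
  moreover obtain b where b: "b \<in> supp w" using assms(3) by blast
  ultimately obtain b' where b': "supp w \<subseteq> {b, b'}"
    by (auto simp: card_1_singleton_iff card_2_iff)
  define c where "c = (if b' \<in> supp w then e j b' else e j b + 1)"
  have bS: "b \<in> S j" using b assms supp_dual by blast
  have split: "int p dvd (\<Sum>x\<in>S j. w x * (e j x - c))"
    using assms(2) by (simp add: dual_def right_diff_distrib sum_subtractf sum_distrib_right [symmetric])
  have rest: "int p dvd (\<Sum>x\<in>S j - {b}. w x * (e j x - c))"
  proof (rule dvd_sum)
    fix x assume x: "x \<in> S j - {b}"
    show "int p dvd w x * (e j x - c)"
    proof (cases "x \<in> supp w")
      case True
      then have "x = b'" using b' x by auto
      then show ?thesis using True by (simp add: c_def)
    next
      case False
      then have "int p dvd w x" using x S_sub assms(1) by (auto simp: supp_def)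
      then show ?thesis by simp
    qed
  qed
  have main: False if h: "b' \<noteq> b"
  proof -
    have "int p dvd w b * (e j b - c)"
      using split rest h bS fin_S[OF assms(1)] by (simp add: sum.remove dvd_add_left_iff)
    moreover have "\<not> int p dvd w b" using b by (simp add: supp_def)
    ultimately have dv: "int p dvd e j b - c"
      using p prime_dvd_mult_iff by (metis prime_int_nat_transfer prime_nat_int_transfer)
    show False
    proof (cases "b' \<in> supp w")
      case True
      then have b'S: "b' \<in> S j" using assms supp_dual by blast
      have "[e j b = e j b'] (mod int p)" using dv True by (simp add: c_def cong_iff_dvd_diff)
      then have "e j b = e j b'" using e_range[OF assms(1)] bS b'S by (simp add: cong_def)
      then show False using h e_inj[OF assms(1)] bS b'S by (auto dest: inj_onD)
    next
      case False
      then show False using dv p by (simp add: c_def prime_gt_1_nat)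
    qed
  qed
  show False
  proof (cases "b' = b")
    case True
    have "supp w = {b}" using b b' True by auto
    then have "int p dvd (\<Sum>x\<in>S j - {b}. w x)"
      using S_sub assms(1) by (intro dvd_sum) (auto simp: supp_def)
    then have "int p dvd w b"
      using assms(2) bS fin_S[OF assms(1)] by (simp add: dual_def sum.remove dvd_add_left_iff)
    then show False using b by (simp add: supp_def)
  qed (use main in simp)
qed

text \<open>Uncancelled coordinates are covered once, cancelled ones at least twice; the expansion bound
  leaves no room for many cancellations.\<close>

lemma support_ge_active:
  assumes u: "combination u" and le: "card (active u) \<le> 6 * t"
  shows "8 * card (active u) \<le> 10 * card (supp (total u))"
proof -
  define K where "K = active u"
  define T where "T = (\<lambda>j. supp (u j))"
  define U where "U = (\<Union>j\<in>K. T j)"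
  define Z where "Z = supp (total u)"
  have KJ: "K \<subseteq> J" and finK: "finite K" using fin_J by (auto simp: K_def active_def)
  have uj: "u j \<in> dual j" if "j \<in> J" for j using u that by (simp add: combination_def)
  have TS: "T j \<subseteq> S j" if "j \<in> K" for j
    using supp_dual uj KJ that by (auto simp: T_def)
  have finT: "finite (T j)" for j by (simp add: T_def finite_supp)
  have finU: "finite U" using finK finT by (simp add: U_def)
  have finZ: "finite Z" by (simp add: Z_def finite_supp)
  have T3: "card (T j) \<ge> 3" if "j \<in> K" for j
    using dual_weight[of j "u j"] uj that by (auto simp: K_def active_def T_def)
  have mult: "card {j\<in>K. b \<in> T j} \<ge> (if b \<in> Z then 1 else 2)" if "b \<in> U" for b
  proof -
    have ne: "card {j\<in>K. b \<in> T j} \<noteq> 0" using that finK by (auto simp: U_def)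
    have bn: "b < n" using that by (auto simp: U_def T_def supp_def)
    have "{j\<in>K. b \<in> T j} = {j\<in>J. \<not> int p dvd u j b}"
      using bn by (auto simp: K_def active_def T_def supp_def)
    then have "b \<in> Z" if "card {j\<in>K. b \<in> T j} = 1"
      using not_dvd_sum_if_unique[OF fin_J, of "int p" "\<lambda>j. u j b"] that bn
      by (simp add: Z_def supp_def total_def)
    then show ?thesis using ne by force
  qed
  have "(\<Sum>j\<in>K. card (T j)) = (\<Sum>j\<in>K. card (T j \<inter> U))"
    by (intro sum.cong refl arg_cong[where f = card]) (auto simp: U_def)
  also have "\<dots> = (\<Sum>b\<in>U. card {j\<in>K. b \<in> T j})"
    by (rule sum_card_Int_eq[OF finK finU])
  also have "\<dots> \<ge> (\<Sum>b\<in>U. if b \<in> Z then 1 else 2)"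
    using mult by (intro sum_mono) auto
  finally have "(\<Sum>b\<in>U. if b \<in> Z then 1 else 2) \<le> (\<Sum>j\<in>K. card (T j))" .
  moreover have "(\<Sum>b\<in>U. if b \<in> Z then 1 else (2::nat)) = card (U \<inter> Z) + 2 * card (U - Z)"
    using finU by (subst sum.If_cases) (auto simp: Diff_eq)
  moreover have "card U = card (U \<inter> Z) + card (U - Z)"
    using finU by (metis card_Int_Diff)
  moreover have "card (U \<inter> Z) \<le> card Z" using finZ by (intro card_mono) auto
  ultimately have A: "2 * card U \<le> (\<Sum>j\<in>K. card (T j)) + card Z" by linarith
  have B: "(\<Sum>j\<in>K. card (T j)) + card (\<Union>j\<in>K. S j) \<le> (\<Sum>j\<in>K. card (S j)) + card U"
    unfolding U_def using finK TS fin_S KJ by (intro excess_mono) auto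
  have C: "10 * (\<Sum>j\<in>K. card (S j)) \<le> 10 * card (\<Union>j\<in>K. S j) + 11 * card K"
    using expanding[OF KJ] le by (simp add: K_def)
  have D: "3 * card K \<le> (\<Sum>j\<in>K. card (T j))"
    using sum_mono[of K "\<lambda>_. 3" "\<lambda>j. card (T j)"] T3 by (simp add: mult.commute)
  show ?thesis using A B C D unfolding K_def [symmetric] Z_def [symmetric] by linarith
qed

lemma active_local:
  assumes u: "combination u" and le: "card (active u) < 6 * t" and j0: "j0 \<in> J"
    and sup: "supp (total u) \<subseteq> S j0"
  shows "active u \<subseteq> {j0}"
proof -
  define K where "K = active u - {j0}"
  define T where "T = (\<lambda>j. supp (u j))"
  define U where "U = (\<Union>j\<in>K. T j) - S j0"
  have KJ: "K \<subseteq> J" and finK: "finite K" and j0K: "j0 \<notin> K" using fin_J by (auto simp: K_def active_def)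
  have uj: "u j \<in> dual j" if "j \<in> J" for j using u that by (simp add: combination_def)
  have TS: "T j \<subseteq> S j" if "j \<in> J" for j
    using supp_dual uj that by (auto simp: T_def)
  have finT: "finite (T j)" for j by (simp add: T_def finite_supp)
  have finU: "finite U" using finK finT by (simp add: U_def)
  have T3: "card (T j) \<ge> 3" if "j \<in> K" for j
    using dual_weight[of j "u j"] uj that by (auto simp: K_def active_def T_def)
  have mult: "card {j\<in>K. b \<in> T j} \<ge> 2" if "b \<in> U" for b
  proof -
    have ne: "card {j\<in>K. b \<in> T j} \<noteq> 0" using that finK by (auto simp: U_def)
    have bn: "b < n" using that by (auto simp: U_def T_def supp_def)
    have "{j\<in>K. b \<in> T j} = {j\<in>J. \<not> int p dvd u j b}"
      using bn that TS[OF j0] by (auto simp: K_def active_def T_def U_def supp_def)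
    moreover have "int p dvd total u b"
      using bn that sup by (auto simp: supp_def U_def)
    ultimately have "card {j\<in>K. b \<in> T j} \<noteq> 1"
      using not_dvd_sum_if_unique[OF fin_J, of "int p" "\<lambda>j. u j b"]
      by (auto simp: total_def)
    then show ?thesis using ne by linarith
  qed
  have "2 * card U \<le> (\<Sum>b\<in>U. card {j\<in>K. b \<in> T j})"
    using sum_mono[of U "\<lambda>_. 2" "\<lambda>b. card {j\<in>K. b \<in> T j}"] mult by (simp add: mult.commute)
  also have "\<dots> = (\<Sum>j\<in>K. card (T j \<inter> U))"
    by (rule sum_card_Int_eq[OF finK finU, symmetric])
  also have "\<dots> \<le> (\<Sum>j\<in>K. card (T j))"
    using finT by (intro sum_mono card_mono) auto
  finally have A: "2 * card U \<le> (\<Sum>j\<in>K. card (T j))" .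
  define T' where "T' = (\<lambda>j. if j = j0 then S j0 else T j)"
  have sT': "(\<Sum>j\<in>insert j0 K. card (T' j)) = card (S j0) + (\<Sum>j\<in>K. card (T j))"
    using finK j0K by (simp add: T'_def) (intro sum.cong refl, auto)
  have uT': "(\<Union>j\<in>insert j0 K. T' j) = S j0 \<union> U"
    using j0K by (auto simp: T'_def U_def split: if_splits)
  have B: "(\<Sum>j\<in>insert j0 K. card (T' j)) + card (\<Union>j\<in>insert j0 K. S j)
      \<le> (\<Sum>j\<in>insert j0 K. card (S j)) + card (\<Union>j\<in>insert j0 K. T' j)"
    using finK TS fin_S KJ j0 by (intro excess_mono) (auto simp: T'_def)
  have "card K \<le> card (active u)" unfolding K_def by (intro card_mono finite_active) auto
  then have cK: "card (insert j0 K) \<le> 6 * t" using le finK j0K by simp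
  have C: "10 * (\<Sum>j\<in>insert j0 K. card (S j)) \<le> 10 * card (\<Union>j\<in>insert j0 K. S j) + 11 * card (insert j0 K)"
    using KJ j0 cK by (intro expanding) auto
  have D: "3 * card K \<le> (\<Sum>j\<in>K. card (T j))"
    using sum_mono[of K "\<lambda>_. 3" "\<lambda>j. card (T j)"] T3 by (simp add: mult.commute)
  have E: "card (S j0 \<union> U) = card (S j0) + card U"
    using finU fin_S[OF j0] by (intro card_Un_disjoint) (auto simp: U_def)
  have cI: "card (insert j0 K) = card K + 1" using finK j0K by simp
  have "card K \<le> 2" using A B C D E cI unfolding sT' uT' by linarith
  have few: "card (T j \<inter> S i) \<le> 1" if "i \<in> J" "j \<in> K" "i \<noteq> j" for i j
  proof -
    have "card (T j \<inter> S i) \<le> card (S j \<inter> S i)"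
      using that KJ TS fin_S by (intro card_mono) auto
    also have "\<dots> \<le> 1" using few_common that KJ by auto
    finally show ?thesis .
  qed
  have big: "card (T j - S j0) \<ge> 2" if "j \<in> K" for j
    using few[OF j0 that] T3[OF that] j0K that card_Int_Diff[OF finT, of j "S j0"] by force
  have "K = {}"
  proof (rule ccontr)
    assume "K \<noteq> {}"
    then obtain j where j: "j \<in> K" by blast
    have "card (K - {j}) \<le> 1" using j \<open>card K \<le> 2\<close> finK by simp
    then obtain i where i: "K - {j} \<subseteq> {i}"
      using finK by (metis card_le_Suc0_iff_eq empty_iff finite_Diff insertI1 One_nat_def subsetI)
    have sub: "T j - S j0 \<subseteq> T i \<and> i \<in> K \<and> i \<noteq> j"
    proof -
      have *: "b \<in> T i \<and> i \<in> K \<and> i \<noteq> j" if "b \<in> T j - S j0" for b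
      proof -
        have "b \<in> U" using that j by (auto simp: U_def)
        then have "card {j\<in>K. b \<in> T j} \<ge> 2" by (rule mult)
        then have "\<not> {j\<in>K. b \<in> T j} \<subseteq> {j}"
          using card_mono[of "{j}" "{j\<in>K. b \<in> T j}"] by auto
        then show ?thesis using i by auto
      qed
      moreover obtain b where "b \<in> T j - S j0" 
        using big[OF j] by (metis card.empty ex_in_conv not_numeral_le_zero)
      ultimately show ?thesis by blast
    qed
    then have "card (T j - S j0) \<le> card (T j \<inter> S i)"
      using TS KJ finT by (intro card_mono) blast+
    then show False using few[of i j] sub j KJ big[OF j] by fastforce
  qed
  then show ?thesis by (auto simp: K_def)
qed

lemma rhs_inactive:
  assumes "combination u" "active u = {}"
  shows "int p dvd rhs u"
  unfolding rhs_def
proof (intro dvd_sum dvd_mult2)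
  fix j b assume "j \<in> J" "b \<in> S j"
  then show "int p dvd u j b" using assms S_sub by (auto simp: active_def supp_def)
qed

lemma active_diff: "active (\<lambda>j b. u j b - u' j b) \<subseteq> active u \<union> active u'"
  unfolding active_def supp_def by auto

lemma active_add: "active (\<lambda>j b. u j b + u' j b) \<subseteq> active u \<union> active u'"
  unfolding active_def supp_def by auto

lemma card_active_diff: "card (active (\<lambda>j b. u j b - u' j b)) \<le> card (active u) + card (active u')"
  by (rule order_trans[OF card_mono[OF _ active_diff] card_Un_le]) (simp add: finite_active)

lemma card_active_add: "card (active (\<lambda>j b. u j b + u' j b)) \<le> card (active u) + card (active u')"
  by (rule order_trans[OF card_mono[OF _ active_add] card_Un_le]) (simp add: finite_active)

lemma derives_diff: "derives u \<psi> \<Longrightarrow> derives u' \<psi>' \<Longrightarrow> derives (\<lambda>j b. u j b - u' j b) (\<lambda>b. \<psi> b - \<psi>' b)"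
  unfolding derives_def combination_def total_def
  by (auto simp: sum_subtractf dual_diff intro: cong_diff)

lemma derives_add: "derives u \<psi> \<Longrightarrow> derives u' \<psi>' \<Longrightarrow> derives (\<lambda>j b. u j b + u' j b) (\<lambda>b. \<psi> b + \<psi>' b)"
  unfolding derives_def combination_def total_def
  by (auto simp: sum.distrib dual_add intro: cong_add)

lemma derives_zero: "derives (\<lambda>_ _. 0) (\<lambda>_. 0)"
  unfolding derives_def combination_def total_def by (simp add: zero_dual)

lemma active_zero: "active (\<lambda>_ _. 0) = {}"
  unfolding active_def supp_def by simp

lemma rhs_diff: "rhs (\<lambda>j b. u j b - u' j b) = rhs u - rhs u'"
  unfolding rhs_def by (simp add: sum_subtractf left_diff_distrib)

lemma rhs_add: "rhs (\<lambda>j b. u j b + u' j b) = rhs u + rhs u'"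
  unfolding rhs_def by (simp add: sum.distrib distrib_right)

lemma supp_total: "derives u \<psi> \<Longrightarrow> supp (total u) = supp \<psi>"
  unfolding derives_def supp_def by (auto simp: cong_dvd_iff)

lemma rhs_unique:
  assumes "derives u \<psi>" "derives u' \<psi>" "card (active u) \<le> 3 * t" "card (active u') \<le> 3 * t"
  shows "[rhs u = rhs u'] (mod int p)"
proof -
  let ?v = "\<lambda>j b. u j b - u' j b"
  have d: "derives ?v (\<lambda>b. 0)" using derives_diff[OF assms(1,2)] by simp
  then have c: "combination ?v" by (simp add: derives_def)
  have "card (active ?v) \<le> 6 * t" using card_active_diff[of u u'] assms by linarith
  then have "8 * card (active ?v) \<le> 10 * card (supp (total ?v))"
    using support_ge_active c by blast
  also have "supp (total ?v) = {}" using supp_total[OF d] by (simp add: supp_def)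
  finally have "active ?v = {}" using finite_active by simp
  then show ?thesis using rhs_inactive[OF c] by (simp add: rhs_diff cong_iff_dvd_diff)
qed

definition pmoment :: "(nat \<Rightarrow> int) \<Rightarrow> complex" where
  "pmoment \<psi> = (if \<exists>u. derives u \<psi> \<and> card (active u) \<le> 3 * t
     then root_char p (rhs (SOME u. derives u \<psi> \<and> card (active u) \<le> 3 * t)) else 0)"

definition derivable :: "(nat \<Rightarrow> int) \<Rightarrow> bool" where
  "derivable \<psi> \<longleftrightarrow> (\<exists>u. derives u \<psi> \<and> card (active u) \<le> 3 * t)"

lemma pmoment_eq:
  assumes "derives u \<psi>" "card (active u) \<le> 3 * t"
  shows "pmoment \<psi> = root_char p (rhs u)"
proof -
  let ?P = "\<lambda>u. derives u \<psi> \<and> card (active u) \<le> 3 * t"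
  have "?P (SOME u. ?P u)" by (rule someI[of ?P u]) (use assms in simp)
  then have "[rhs (SOME u. ?P u) = rhs u] (mod int p)" using rhs_unique assms by blast
  then have "root_char p (rhs (SOME u. ?P u)) = root_char p (rhs u)"
    by (rule root_char_cong[OF p_pos])
  moreover have "pmoment \<psi> = root_char p (rhs (SOME u. ?P u))"
    using assms by (auto simp: pmoment_def)
  ultimately show ?thesis by simp
qed

lemma pmoment_not_derivable: "\<not> derivable \<psi> \<Longrightarrow> pmoment \<psi> = 0"
  unfolding derivable_def pmoment_def by (rule if_not_P)

lemma pmoment_cong:
  assumes "\<And>b. b < n \<Longrightarrow> [\<psi> b = \<psi>' b] (mod int p)"
  shows "pmoment \<psi> = pmoment \<psi>'"
proof -
  have "derives u \<psi> = derives u \<psi>'" for u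
    unfolding derives_def using assms cong_sym cong_trans by meson
  then show ?thesis unfolding pmoment_def by (simp only:)
qed

lemma derivable_zero: "derivable (\<lambda>_. 0)"
  unfolding derivable_def by (rule exI[of _ "\<lambda>_ _. 0"]) (simp add: derives_zero active_zero)

lemma derivable_uminus:
  assumes "derivable (\<lambda>b. \<psi> b - \<psi>' b)"
  shows "derivable (\<lambda>b. \<psi>' b - \<psi> b)" "pmoment (\<lambda>b. \<psi>' b - \<psi> b) = cnj (pmoment (\<lambda>b. \<psi> b - \<psi>' b))"
proof -
  obtain u where u: "derives u (\<lambda>b. \<psi> b - \<psi>' b)" "card (active u) \<le> 3 * t"
    using assms unfolding derivable_def by blast
  let ?v = "\<lambda>j b. 0 - u j b"
  have v: "derives ?v (\<lambda>b. \<psi>' b - \<psi> b)" using derives_diff[OF derives_zero u(1)] by simp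
  have c: "card (active ?v) \<le> 3 * t"
    using card_active_diff[of "\<lambda>_ _. 0" u] u(2) by (simp add: active_zero)
  show "derivable (\<lambda>b. \<psi>' b - \<psi> b)" using v c derivable_def by blast
  show "pmoment (\<lambda>b. \<psi>' b - \<psi> b) = cnj (pmoment (\<lambda>b. \<psi> b - \<psi>' b))"
    using pmoment_eq[OF v c] pmoment_eq[OF u] rhs_diff[of "\<lambda>_ _. 0" u]
    by (simp add: rhs_def root_char_uminus)
qed

lemma derivable_trans:
  assumes "derivable (\<lambda>b. \<psi> b - \<psi>' b)" "derivable (\<lambda>b. \<psi>' b - \<psi>'' b)"
    and w: "card (supp \<psi>) \<le> t" "card (supp \<psi>'') \<le> t"
  shows "derivable (\<lambda>b. \<psi> b - \<psi>'' b)"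
    and "pmoment (\<lambda>b. \<psi> b - \<psi>'' b) = pmoment (\<lambda>b. \<psi> b - \<psi>' b) * pmoment (\<lambda>b. \<psi>' b - \<psi>'' b)"
proof -
  obtain u where u: "derives u (\<lambda>b. \<psi> b - \<psi>' b)" "card (active u) \<le> 3 * t"
    using assms unfolding derivable_def by blast
  obtain u' where u': "derives u' (\<lambda>b. \<psi>' b - \<psi>'' b)" "card (active u') \<le> 3 * t"
    using assms unfolding derivable_def by blast
  let ?v = "\<lambda>j b. u j b + u' j b"
  have v: "derives ?v (\<lambda>b. \<psi> b - \<psi>'' b)" using derives_add[OF u(1) u'(1)] by simp
  have "card (active ?v) \<le> 6 * t" using card_active_add[of u u'] u u' by linarith
  then have 8: "8 * card (active ?v) \<le> 10 * card (supp (total ?v))"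
    using support_ge_active v unfolding derives_def by blast
  have "card (supp (total ?v)) = card (supp (\<lambda>b. \<psi> b - \<psi>'' b))" by (simp only: supp_total[OF v])
  also have "\<dots> \<le> card (supp \<psi> \<union> supp \<psi>'')"
    using finite_supp by (intro card_mono) (auto simp: supp_def)
  also have "\<dots> \<le> card (supp \<psi>) + card (supp \<psi>'')" by (rule card_Un_le)
  finally have c: "card (active ?v) \<le> 3 * t" using w 8 by linarith
  show "derivable (\<lambda>b. \<psi> b - \<psi>'' b)" using v c derivable_def by blast
  show "pmoment (\<lambda>b. \<psi> b - \<psi>'' b) = pmoment (\<lambda>b. \<psi> b - \<psi>' b) * pmoment (\<lambda>b. \<psi>' b - \<psi>'' b)"
    using pmoment_eq[OF v c] pmoment_eq[OF u] pmoment_eq[OF u'] by (simp add: rhs_add root_char_add)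
qed

text \<open>Derivability of the difference is an equivalence relation on characters of weight at most \<open>t\<close>, and
  \<open>pmoment\<close> has rank one on each class, so it is a Gram matrix.\<close>

lemma pmoment_psd:
  fixes c :: "'b \<Rightarrow> complex"
  assumes fin: "finite I" and w: "\<And>a. a \<in> I \<Longrightarrow> card (supp (\<psi> a)) \<le> t"
  shows "0 \<le> Re (\<Sum>a\<in>I. \<Sum>b\<in>I. c a * cnj (c b) * pmoment (\<lambda>x. \<psi> a x - \<psi> b x))"
proof -
  define rel where "rel = (\<lambda>a b. derivable (\<lambda>x. \<psi> a x - \<psi> b x))"
  define r where "r = (\<lambda>a. SOME b. b \<in> I \<and> rel b a)"
  define G where "G = (\<lambda>k a. if r a = k then pmoment (\<lambda>x. \<psi> a x - \<psi> k x) else 0)"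
  have rel_refl: "rel a a" for a using derivable_zero by (simp add: rel_def)
  have rel_sym: "rel a b \<Longrightarrow> rel b a" for a b unfolding rel_def by (rule derivable_uminus)
  have rel_trans: "rel a b \<Longrightarrow> rel b c \<Longrightarrow> a \<in> I \<Longrightarrow> c \<in> I \<Longrightarrow> rel a c" for a b c
    unfolding rel_def using derivable_trans(1) w by blast
  have r: "r a \<in> I \<and> rel (r a) a" if "a \<in> I" for a
    unfolding r_def by (rule someI[of _ a]) (use that rel_refl in simp)
  have r_eq: "r a = r b" if "rel a b" "a \<in> I" "b \<in> I" for a b
  proof -
    have "(\<lambda>x. x \<in> I \<and> rel x a) = (\<lambda>x. x \<in> I \<and> rel x b)"
      using that rel_sym rel_trans by blast
    then show ?thesis unfolding r_def by simp
  qed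
  have gram: "pmoment (\<lambda>x. \<psi> a x - \<psi> b x) = (\<Sum>k\<in>r ` I. G k a * cnj (G k b))"
    if ab: "a \<in> I" "b \<in> I" for a b
  proof -
    have "(\<Sum>k\<in>r ` I. G k a * cnj (G k b)) = (\<Sum>k\<in>r ` I. if k = r a then G k a * cnj (G k b) else 0)"
      by (intro sum.cong refl) (auto simp: G_def)
    also have "\<dots> = G (r a) a * cnj (G (r a) b)" using fin ab by simp
    also have "\<dots> = pmoment (\<lambda>x. \<psi> a x - \<psi> b x)"
    proof (cases "rel a b")
      case True
      have "r a = r b" using r_eq True ab by blast
      then have 1: "rel a (r a)" "rel (r a) b" using r ab rel_sym by metis+
      have "pmoment (\<lambda>x. \<psi> a x - \<psi> b x)
          = pmoment (\<lambda>x. \<psi> a x - \<psi> (r a) x) * pmoment (\<lambda>x. \<psi> (r a) x - \<psi> b x)"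
        using 1 ab w unfolding rel_def by (intro derivable_trans(2)) auto
      also have "pmoment (\<lambda>x. \<psi> (r a) x - \<psi> b x) = cnj (pmoment (\<lambda>x. \<psi> b x - \<psi> (r a) x))"
        using 1 rel_sym unfolding rel_def by (intro derivable_uminus(2)) blast
      finally show ?thesis using \<open>r a = r b\<close> by (simp add: G_def)
    next
      case False
      then have "r a \<noteq> r b" using r ab rel_sym rel_trans by metis
      then show ?thesis using False by (simp add: G_def rel_def pmoment_not_derivable)
    qed
    finally show ?thesis ..
  qed
  have "(\<Sum>a\<in>I. \<Sum>b\<in>I. c a * cnj (c b) * pmoment (\<lambda>x. \<psi> a x - \<psi> b x))
      = (\<Sum>a\<in>I. \<Sum>b\<in>I. \<Sum>k\<in>r ` I. (c a * G k a) * cnj (c b * G k b))"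
  proof (rule sum.cong[OF refl], rule sum.cong[OF refl])
    fix a b assume "a \<in> I" "b \<in> I"
    then show "c a * cnj (c b) * pmoment (\<lambda>x. \<psi> a x - \<psi> b x)
        = (\<Sum>k\<in>r ` I. (c a * G k a) * cnj (c b * G k b))"
      by (simp add: gram sum_distrib_left mult_ac)
  qed
  also have "\<dots> = (\<Sum>a\<in>I. \<Sum>k\<in>r ` I. \<Sum>b\<in>I. (c a * G k a) * cnj (c b * G k b))"
    by (intro sum.cong refl sum.swap)
  also have "\<dots> = (\<Sum>k\<in>r ` I. \<Sum>a\<in>I. \<Sum>b\<in>I. (c a * G k a) * cnj (c b * G k b))"
    by (rule sum.swap)
  also have "\<dots> = (\<Sum>k\<in>r ` I. (\<Sum>a\<in>I. c a * G k a) * cnj (\<Sum>a\<in>I. c a * G k a))"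
    by (simp add: sum_product)
  also have "\<dots> = (\<Sum>k\<in>r ` I. of_real ((cmod (\<Sum>a\<in>I. c a * G k a))\<^sup>2))"
    by (simp only: complex_norm_square)
  also have "Re \<dots> = (\<Sum>k\<in>r ` I. (cmod (\<Sum>a\<in>I. c a * G k a))\<^sup>2)"
    by simp
  finally show ?thesis by (simp add: sum_nonneg)
qed

lemma pmoment_local:
  assumes j: "j \<in> J" and \<psi>: "\<And>b. b \<notin> S j \<Longrightarrow> \<psi> b = 0"
  shows "pmoment \<psi> = (if \<psi> \<in> dual j then root_char p (\<Sum>b\<in>S j. \<psi> b * s j b) else 0)"
proof (cases "\<psi> \<in> dual j")
  case True
  define u where "u = (\<lambda>i. if i = j then \<psi> else (\<lambda>_. 0))"
  have tot: "total u b = \<psi> b" for b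
  proof -
    have "total u b = (\<Sum>i\<in>J. if i = j then \<psi> b else 0)"
      unfolding total_def u_def by (intro sum.cong) auto
    then show ?thesis using j fin_J by simp
  qed
  have "derives u \<psi>" using True tot by (simp add: derives_def combination_def u_def zero_dual)
  moreover have "active u \<subseteq> {j}" by (auto simp: active_def u_def supp_def)
  then have "card (active u) \<le> 3 * t" using t card_mono[of "{j}" "active u"] by simp
  ultimately have "pmoment \<psi> = root_char p (rhs u)" by (rule pmoment_eq)
  also have "rhs u = (\<Sum>i\<in>J. if i = j then (\<Sum>b\<in>S j. \<psi> b * s j b) else 0)"
    unfolding rhs_def u_def by (intro sum.cong) auto
  also have "\<dots> = (\<Sum>b\<in>S j. \<psi> b * s j b)" using j fin_J by simp
  finally show ?thesis using True by simp
next
  case False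
  have "\<not> derivable \<psi>"
  proof
    assume "derivable \<psi>"
    then obtain u where u: "derives u \<psi>" "card (active u) \<le> 3 * t" by (auto simp: derivable_def)
    have cu: "combination u" using u by (simp add: derives_def)
    have "supp (total u) \<subseteq> S j"
    proof
      fix b assume "b \<in> supp (total u)"
      then show "b \<in> S j" unfolding supp_total[OF u(1)] using \<psi>[of b] by (cases "b \<in> S j") (auto simp: supp_def)
    qed
    then have "active u \<subseteq> {j}"
      using t u j cu by (intro active_local) auto
    then have dv: "int p dvd u i b" if "i \<in> J" "i \<noteq> j" "b < n" for i b
      using that by (auto simp: active_def supp_def)
    have cg: "[\<psi> b = u j b] (mod int p)" if "b \<in> S j" for b
    proof -
      have bn: "b < n" using that S_sub j by auto
      have "int p dvd (\<Sum>i\<in>J - {j}. u i b)" using dv bn by (intro dvd_sum) auto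
      then have "[total u b = u j b] (mod int p)"
        using j fin_J by (simp add: total_def sum.remove cong_iff_dvd_diff)
      then show ?thesis using u bn by (auto simp: derives_def intro: cong_trans cong_sym)
    qed
    have uj: "u j \<in> dual j" using cu j by (simp add: combination_def)
    have "[(\<Sum>b\<in>S j. \<psi> b) = (\<Sum>b\<in>S j. u j b)] (mod int p)"
      using cg by (intro cong_sum) auto
    moreover have "[(\<Sum>b\<in>S j. \<psi> b * e j b) = (\<Sum>b\<in>S j. u j b * e j b)] (mod int p)"
      using cg by (intro cong_sum cong_mult) auto
    ultimately have "\<psi> \<in> dual j" using uj \<psi> by (simp add: dual_def cong_dvd_iff)
    then show False using False by simp
  qed
  then show ?thesis using False by (simp add: pmoment_not_derivable)
qed

definition points :: "(nat \<Rightarrow> int) set" where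
  "points = PiE {..<n} (\<lambda>_. {0..<int p})"

definition pdensity :: "(nat \<Rightarrow> int) \<Rightarrow> complex" where
  "pdensity x = (\<Sum>\<eta>\<in>points. pmoment \<eta> * root_char p (- (\<Sum>b<n. \<eta> b * x b)))"

definition pexp :: "((nat \<Rightarrow> int) \<Rightarrow> complex) \<Rightarrow> complex" where
  "pexp F = (\<Sum>x\<in>points. F x * pdensity x) / of_nat p ^ n"

lemma finite_points: "finite points"
  unfolding points_def by (intro finite_PiE) auto

lemma pexp_sum: "pexp (\<lambda>x. \<Sum>a\<in>I. F a x) = (\<Sum>a\<in>I. pexp (F a))"
proof -
  have "(\<Sum>x\<in>points. (\<Sum>a\<in>I. F a x) * pdensity x) = (\<Sum>x\<in>points. \<Sum>a\<in>I. F a x * pdensity x)"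
    by (simp only: sum_distrib_right)
  also have "\<dots> = (\<Sum>a\<in>I. \<Sum>x\<in>points. F a x * pdensity x)"
    by (rule sum.swap)
  finally show ?thesis by (simp only: pexp_def sum_divide_distrib)
qed

lemma pexp_mult: "pexp (\<lambda>x. c * F x) = c * pexp F"
  unfolding pexp_def by (simp add: sum_distrib_left mult.assoc)

lemma pexp_cong: "(\<And>x. x \<in> points \<Longrightarrow> F x = G x) \<Longrightarrow> pexp F = pexp G"
  unfolding pexp_def by simp

lemma pexp_char: "pexp (\<lambda>x. root_char p (\<Sum>b<n. \<theta> b * x b)) = pmoment \<theta>"
proof -
  define \<theta>' where "\<theta>' = restrict (\<lambda>b. \<theta> b mod int p) {..<n}"
  have \<theta>': "\<theta>' \<in> points" using p_pos by (auto simp: \<theta>'_def points_def)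
  have iff: "(\<forall>b\<in>{..<n}. int p dvd \<theta> b - \<eta> b) \<longleftrightarrow> \<eta> = \<theta>'" if "\<eta> \<in> points" for \<eta>
  proof
    assume *: "\<forall>b\<in>{..<n}. int p dvd \<theta> b - \<eta> b"
    show "\<eta> = \<theta>'"
    proof
      fix b show "\<eta> b = \<theta>' b"
      proof (cases "b < n")
        case True
        then have "[\<theta> b = \<eta> b] (mod int p)" using * by (simp add: cong_iff_dvd_diff)
        moreover have "\<eta> b \<in> {0..<int p}" using PiE_mem[OF that[unfolded points_def], of b] True by simp
        ultimately show ?thesis using True by (simp add: cong_def \<theta>'_def)
      qed (use that in \<open>auto simp: points_def PiE_def extensional_def \<theta>'_def\<close>)
    qed
  qed (auto simp: \<theta>'_def mod_eq_dvd_iff [symmetric])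
  have char_mult: "root_char p (\<Sum>b<n. \<theta> b * x b) * (pmoment \<eta> * root_char p (- (\<Sum>b<n. \<eta> b * x b)))
      = pmoment \<eta> * root_char p (\<Sum>b<n. (\<theta> b - \<eta> b) * x b)" for x \<eta>
    by (simp only: left_diff_distrib sum_subtractf root_char_diff root_char_uminus mult.left_commute)
  have "pexp (\<lambda>x. root_char p (\<Sum>b<n. \<theta> b * x b))
      = (\<Sum>x\<in>points. \<Sum>\<eta>\<in>points. pmoment \<eta> * root_char p (\<Sum>b<n. (\<theta> b - \<eta> b) * x b) / of_nat p ^ n)"
    unfolding pexp_def pdensity_def sum_distrib_left sum_divide_distrib
    by (simp only: char_mult)
  also have "\<dots> = (\<Sum>\<eta>\<in>points. \<Sum>x\<in>points. pmoment \<eta> * root_char p (\<Sum>b<n. (\<theta> b - \<eta> b) * x b) / of_nat p ^ n)"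
    by (rule sum.swap)
  also have "\<dots> = (\<Sum>\<eta>\<in>points. pmoment \<eta> * (\<Sum>x\<in>points. root_char p (\<Sum>b<n. (\<theta> b - \<eta> b) * x b)) / of_nat p ^ n)"
    by (simp add: sum_distrib_left sum_divide_distrib)
  also have "\<dots> = (\<Sum>\<eta>\<in>points. if \<eta> = \<theta>' then pmoment \<eta> else 0)"
  proof (intro sum.cong refl)
    fix \<eta> assume "\<eta> \<in> points"
    then show "pmoment \<eta> * (\<Sum>x\<in>points. root_char p (\<Sum>b<n. (\<theta> b - \<eta> b) * x b)) / of_nat p ^ n
        = (if \<eta> = \<theta>' then pmoment \<eta> else 0)"
      using sum_root_char_PiE[OF p_pos, of "{..<n}" "\<lambda>b. \<theta> b - \<eta> b"] p_pos iff[of \<eta>]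
      by (simp add: points_def)
  qed
  also have "\<dots> = pmoment \<theta>'" using finite_points \<theta>' by simp
  also have "\<dots> = pmoment \<theta>" by (rule pmoment_cong) (simp add: \<theta>'_def cong_def)
  finally show ?thesis .
qed

lemma junta_char:
  assumes "T \<subseteq> {..<n}" and "\<And>x. x \<in> points \<Longrightarrow> F (restrict x T) = F x"
  obtains c where "\<And>x. x \<in> points \<Longrightarrow>
    F x = (\<Sum>\<kappa>\<in>PiE T (\<lambda>_. {0..<int p}). c \<kappa> * root_char p (\<Sum>b<n. (if b \<in> T then \<kappa> b else 0) * x b))"
proof -
  have finT: "finite T" using assms(1) finite_subset by blast
  obtain c where c: "\<And>x. x \<in> T \<rightarrow> {0..<int p} \<Longrightarrow> F (restrict x T) = F x \<Longrightarrow>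
    F x = (\<Sum>\<kappa>\<in>PiE T (\<lambda>_. {0..<int p}). c \<kappa> * root_char p (\<Sum>b\<in>T. \<kappa> b * x b))"
    using junta_expansion[OF p_pos finT, of F] by blast
  have eq: "(\<Sum>b<n. (if b \<in> T then \<kappa> b else 0) * x b) = (\<Sum>b\<in>T. \<kappa> b * x b)" for \<kappa> x :: "nat \<Rightarrow> int"
    using assms(1) by (intro sum.mono_neutral_cong_right) auto
  show ?thesis
  proof (rule that[of c])
    fix x assume x: "x \<in> points"
    then have "x \<in> T \<rightarrow> {0..<int p}" using assms(1) by (auto simp: points_def PiE_def Pi_def)
    then show "F x = (\<Sum>\<kappa>\<in>PiE T (\<lambda>_. {0..<int p}). c \<kappa> * root_char p (\<Sum>b<n. (if b \<in> T then \<kappa> b else 0) * x b))"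
      unfolding eq using c assms(2) x by blast
  qed
qed

lemma pexp_square_nonneg:
  fixes F :: "'b \<Rightarrow> (nat \<Rightarrow> int) \<Rightarrow> real"
  assumes fin: "finite I" and T: "\<And>a. a \<in> I \<Longrightarrow> T a \<subseteq> {..<n} \<and> card (T a) \<le> t"
    and dep: "\<And>a x. a \<in> I \<Longrightarrow> x \<in> points \<Longrightarrow> F a (restrict x (T a)) = F a x"
  shows "0 \<le> Re (pexp (\<lambda>x. of_real ((\<Sum>a\<in>I. F a x)\<^sup>2)))"
proof -
  let ?X = "\<lambda>a. PiE (T a) (\<lambda>_. {0..<int p})"
  let ?chi = "\<lambda>(a, \<kappa>). \<lambda>b. if b \<in> T a then \<kappa> b else 0 :: int"
  have "\<exists>c. \<forall>x\<in>points. complex_of_real (F a x) = (\<Sum>\<kappa>\<in>?X a. c \<kappa> * root_char p (\<Sum>b<n. ?chi (a, \<kappa>) b * x b))"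
    if a: "a \<in> I" for a
  proof -
    obtain c where "\<And>x. x \<in> points \<Longrightarrow> complex_of_real (F a x) =
      (\<Sum>\<kappa>\<in>?X a. c \<kappa> * root_char p (\<Sum>b<n. (if b \<in> T a then \<kappa> b else 0) * x b))"
      using junta_char[of "T a" "\<lambda>x. complex_of_real (F a x)"] T[OF a] dep[OF a] by auto
    then show ?thesis by auto
  qed
  then have "\<exists>c. \<forall>a\<in>I. \<forall>x\<in>points. complex_of_real (F a x)
      = (\<Sum>\<kappa>\<in>?X a. c a \<kappa> * root_char p (\<Sum>b<n. ?chi (a, \<kappa>) b * x b))"
    by (intro bchoice ballI)
  then obtain c where c: "\<And>a x. a \<in> I \<Longrightarrow> x \<in> points \<Longrightarrow>
      complex_of_real (F a x) = (\<Sum>\<kappa>\<in>?X a. c a \<kappa> * root_char p (\<Sum>b<n. ?chi (a, \<kappa>) b * x b))"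
    by blast
  define X where "X = Sigma I ?X"
  define d where "d = (\<lambda>(a, \<kappa>). c a \<kappa>)"
  have finT: "finite (T a)" if "a \<in> I" for a using T[OF that] finite_subset by blast
  have finX: "finite X" unfolding X_def using fin finT by (intro finite_SigmaI finite_PiE) auto
  have P: "complex_of_real (\<Sum>a\<in>I. F a x) = (\<Sum>k\<in>X. d k * root_char p (\<Sum>b<n. ?chi k b * x b))"
    if "x \<in> points" for x
  proof -
    have "complex_of_real (\<Sum>a\<in>I. F a x) = (\<Sum>a\<in>I. \<Sum>\<kappa>\<in>?X a. c a \<kappa> * root_char p (\<Sum>b<n. ?chi (a, \<kappa>) b * x b))"
      using c that by simp
    also have "\<dots> = (\<Sum>k\<in>X. d k * root_char p (\<Sum>b<n. ?chi k b * x b))"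
      unfolding X_def using fin finT by (subst sum.Sigma) (auto simp: d_def intro!: finite_PiE sum.cong)
    finally show ?thesis .
  qed
  have sq: "complex_of_real ((\<Sum>a\<in>I. F a x)\<^sup>2)
      = (\<Sum>k\<in>X. \<Sum>l\<in>X. d k * cnj (d l) * root_char p (\<Sum>b<n. (?chi k b - ?chi l b) * x b))"
    if "x \<in> points" for x
  proof -
    have "complex_of_real ((\<Sum>a\<in>I. F a x)\<^sup>2) = complex_of_real (\<Sum>a\<in>I. F a x) * cnj (complex_of_real (\<Sum>a\<in>I. F a x))"
      unfolding complex_cnj_complex_of_real by (simp add: power2_eq_square)
    also have "\<dots> = (\<Sum>k\<in>X. \<Sum>l\<in>X. (d k * root_char p (\<Sum>b<n. ?chi k b * x b)) * cnj (d l * root_char p (\<Sum>b<n. ?chi l b * x b)))"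
      unfolding P[OF that] cnj_sum sum_product ..
    also have "\<dots> = (\<Sum>k\<in>X. \<Sum>l\<in>X. d k * cnj (d l) * root_char p (\<Sum>b<n. (?chi k b - ?chi l b) * x b))"
      unfolding left_diff_distrib sum_subtractf root_char_diff complex_cnj_mult
      by (intro sum.cong refl) (simp only: mult_ac)
    finally show ?thesis .
  qed
  have "pexp (\<lambda>x. of_real ((\<Sum>a\<in>I. F a x)\<^sup>2))
      = pexp (\<lambda>x. \<Sum>k\<in>X. \<Sum>l\<in>X. d k * cnj (d l) * root_char p (\<Sum>b<n. (?chi k b - ?chi l b) * x b))"
    using sq by (intro pexp_cong) auto
  also have "\<dots> = (\<Sum>k\<in>X. \<Sum>l\<in>X. d k * cnj (d l) * pmoment (\<lambda>b. ?chi k b - ?chi l b))"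
    by (simp only: pexp_sum pexp_mult pexp_char)
  also have "0 \<le> Re \<dots>"
  proof (rule pmoment_psd[OF finX])
    fix k assume "k \<in> X"
    then obtain a \<kappa> where k: "k = (a, \<kappa>)" "a \<in> I" by (auto simp: X_def)
    have "card (supp (?chi k)) \<le> card (T a)"
      using finT k by (intro card_mono) (auto simp: supp_def split: if_splits)
    then show "card (supp (?chi k)) \<le> t" using T[OF k(2)] by simp
  qed
  finally show ?thesis .
qed

lemma pexp_local:
  assumes j: "j \<in> J" and dep: "\<And>x. F (restrict x (S j)) = F x"
  shows "pexp F = (\<Sum>\<alpha>\<in>{0..<int p}. \<Sum>\<beta>\<in>{0..<int p}. F (\<lambda>b. (s j b + \<alpha> + \<beta> * e j b) mod int p)) / (of_nat p)\<^sup>2"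
proof -
  let ?X = "PiE (S j) (\<lambda>_. {0..<int p})" and ?Z = "{0..<int p}"
  let ?chi = "\<lambda>\<kappa> b. if b \<in> S j then \<kappa> b else (0::int)"
  obtain c where c: "\<And>x. x \<in> S j \<rightarrow> {0..<int p} \<Longrightarrow> F (restrict x (S j)) = F x \<Longrightarrow>
    F x = (\<Sum>\<kappa>\<in>?X. c \<kappa> * root_char p (\<Sum>b\<in>S j. \<kappa> b * x b))"
    using junta_expansion[OF p_pos fin_S[OF j], of F] by blast
  have eq: "(\<Sum>b\<in>S j. \<kappa> b * x b) = (\<Sum>b<n. ?chi \<kappa> b * x b)" for \<kappa> x :: "nat \<Rightarrow> int"
    using S_sub[OF j] by (intro sum.mono_neutral_cong_left) auto
  have "pexp F = pexp (\<lambda>x. \<Sum>\<kappa>\<in>?X. c \<kappa> * root_char p (\<Sum>b<n. ?chi \<kappa> b * x b))"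
  proof (rule pexp_cong)
    fix x assume x: "x \<in> points"
    then have "x \<in> S j \<rightarrow> {0..<int p}" using S_sub[OF j] by (auto simp: points_def PiE_def Pi_def)
    then show "F x = (\<Sum>\<kappa>\<in>?X. c \<kappa> * root_char p (\<Sum>b<n. ?chi \<kappa> b * x b))"
      using c[OF _ dep, of x] by (simp only: eq)
  qed
  also have "\<dots> = (\<Sum>\<kappa>\<in>?X. c \<kappa> * pmoment (?chi \<kappa>))"
    by (simp only: pexp_sum pexp_mult pexp_char)
  also have "\<dots> = (\<Sum>\<kappa>\<in>?X. c \<kappa> * ((\<Sum>\<alpha>\<in>?Z. \<Sum>\<beta>\<in>?Z. root_char p (\<Sum>b\<in>S j. \<kappa> b * (s j b + \<alpha> + \<beta> * e j b))) / (of_nat p)\<^sup>2))"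
  proof (intro sum.cong refl arg_cong2[where f = "(*)"])
    fix \<kappa>
    have d: "?chi \<kappa> \<in> dual j \<longleftrightarrow> int p dvd (\<Sum>b\<in>S j. \<kappa> b) \<and> int p dvd (\<Sum>b\<in>S j. \<kappa> b * e j b)"
      by (simp add: dual_def)
    have "(\<Sum>b\<in>S j. \<kappa> b * (s j b + \<alpha> + \<beta> * e j b))
        = (\<Sum>b\<in>S j. \<kappa> b * s j b) + ((\<Sum>b\<in>S j. \<kappa> b) * \<alpha> + (\<Sum>b\<in>S j. \<kappa> b * e j b) * \<beta>)" for \<alpha> \<beta>
      by (simp add: algebra_simps sum.distrib sum_distrib_left sum_distrib_right)
    then have eq2: "root_char p (\<Sum>b\<in>S j. \<kappa> b * (s j b + \<alpha> + \<beta> * e j b))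
        = root_char p (\<Sum>b\<in>S j. \<kappa> b * s j b)
            * (root_char p ((\<Sum>b\<in>S j. \<kappa> b) * \<alpha>) * root_char p ((\<Sum>b\<in>S j. \<kappa> b * e j b) * \<beta>))" for \<alpha> \<beta>
      by (simp only: root_char_add)
    have "(\<Sum>\<alpha>\<in>?Z. \<Sum>\<beta>\<in>?Z. root_char p (\<Sum>b\<in>S j. \<kappa> b * (s j b + \<alpha> + \<beta> * e j b)))
        = (\<Sum>\<alpha>\<in>?Z. \<Sum>\<beta>\<in>?Z. root_char p (\<Sum>b\<in>S j. \<kappa> b * s j b)
            * (root_char p ((\<Sum>b\<in>S j. \<kappa> b) * \<alpha>) * root_char p ((\<Sum>b\<in>S j. \<kappa> b * e j b) * \<beta>)))"
      by (simp only: eq2)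
    also have "\<dots> = root_char p (\<Sum>b\<in>S j. \<kappa> b * s j b)
        * ((\<Sum>\<alpha>\<in>?Z. root_char p ((\<Sum>b\<in>S j. \<kappa> b) * \<alpha>)) * (\<Sum>\<beta>\<in>?Z. root_char p ((\<Sum>b\<in>S j. \<kappa> b * e j b) * \<beta>)))"
      unfolding sum_product by (simp only: sum_distrib_left)
    also have "\<dots> = (if ?chi \<kappa> \<in> dual j then root_char p (\<Sum>b\<in>S j. \<kappa> b * s j b) * (of_nat p)\<^sup>2 else 0)"
      unfolding d sum_root_char[OF p_pos] by (simp add: power2_eq_square)
    finally show "pmoment (?chi \<kappa>) = (\<Sum>\<alpha>\<in>?Z. \<Sum>\<beta>\<in>?Z. root_char p (\<Sum>b\<in>S j. \<kappa> b * (s j b + \<alpha> + \<beta> * e j b))) / (of_nat p)\<^sup>2"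
      using p_pos pmoment_local[OF j, of "?chi \<kappa>"] by (simp cong: sum.cong)
  qed
  also have "\<dots> = (\<Sum>\<kappa>\<in>?X. \<Sum>\<alpha>\<in>?Z. \<Sum>\<beta>\<in>?Z. c \<kappa> * root_char p (\<Sum>b\<in>S j. \<kappa> b * (s j b + \<alpha> + \<beta> * e j b))) / (of_nat p)\<^sup>2"
    by (simp add: sum_distrib_left sum_divide_distrib)
  also have "(\<Sum>\<kappa>\<in>?X. \<Sum>\<alpha>\<in>?Z. \<Sum>\<beta>\<in>?Z. c \<kappa> * root_char p (\<Sum>b\<in>S j. \<kappa> b * (s j b + \<alpha> + \<beta> * e j b)))
     = (\<Sum>\<alpha>\<in>?Z. \<Sum>\<kappa>\<in>?X. \<Sum>\<beta>\<in>?Z. c \<kappa> * root_char p (\<Sum>b\<in>S j. \<kappa> b * (s j b + \<alpha> + \<beta> * e j b)))"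
    by (rule sum.swap)
  also have "\<dots> = (\<Sum>\<alpha>\<in>?Z. \<Sum>\<beta>\<in>?Z. \<Sum>\<kappa>\<in>?X. c \<kappa> * root_char p (\<Sum>b\<in>S j. \<kappa> b * (s j b + \<alpha> + \<beta> * e j b)))"
    by (intro sum.cong refl sum.swap)
  also have "\<dots> = (\<Sum>\<alpha>\<in>?Z. \<Sum>\<beta>\<in>?Z. F (\<lambda>b. (s j b + \<alpha> + \<beta> * e j b) mod int p))"
  proof (intro sum.cong refl)
    fix \<alpha> \<beta>
    let ?x = "\<lambda>b. (s j b + \<alpha> + \<beta> * e j b) mod int p"
    have "F ?x = (\<Sum>\<kappa>\<in>?X. c \<kappa> * root_char p (\<Sum>b\<in>S j. \<kappa> b * ?x b))"
      using p_pos by (intro c dep) auto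
    also have "\<dots> = (\<Sum>\<kappa>\<in>?X. c \<kappa> * root_char p (\<Sum>b\<in>S j. \<kappa> b * (s j b + \<alpha> + \<beta> * e j b)))"
      by (intro sum.cong refl arg_cong2[where f = "(*)"] root_char_cong[OF p_pos] cong_sum cong_mult) (simp_all add: cong_def)
    finally show "(\<Sum>\<kappa>\<in>?X. c \<kappa> * root_char p (\<Sum>b\<in>S j. \<kappa> b * (s j b + \<alpha> + \<beta> * e j b))) = F ?x" ..
  qed
  finally show ?thesis .
qed

end

section \<open>The Lasserre solution\<close>

definition block :: "nat \<Rightarrow> nat \<Rightarrow> nat" where
  "block p i = (i - 1) div p"

definition marked :: "nat \<Rightarrow> nat \<Rightarrow> nat \<Rightarrow> (nat \<Rightarrow> int) \<Rightarrow> nat \<Rightarrow> bool" where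
  "marked p n a x i \<longleftrightarrow> block p i < n \<and> (x (block p i) + int i) mod int p < int a"

lemma sum_shift_mod:
  fixes f :: "int \<Rightarrow> nat"
  assumes "p > 0"
  shows "(\<Sum>i\<in>{m..<m + p}. f ((c + int i) mod int p)) = (\<Sum>v\<in>{0..<int p}. f v)"
proof -
  let ?g = "\<lambda>i. (c + int i) mod int p"
  have inj: "inj_on ?g {m..<m + p}"
  proof (rule inj_onI)
    fix i k assume ik: "i \<in> {m..<m + p}" "k \<in> {m..<m + p}" and "?g i = ?g k"
    then have "int p dvd int i - int k" by (simp add: mod_eq_dvd_iff)
    moreover have "\<bar>int i - int k\<bar> < int p" using ik by auto
    ultimately have "int i - int k = 0" using dvd_imp_le_int[of "int i - int k" "int p"] by linarith
    then show "i = k" by simp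
  qed
  have "?g ` {m..<m + p} = {0..<int p}"
  proof (rule card_subset_eq)
    show "card (?g ` {m..<m + p}) = card {0..<int p}" using inj by (simp add: card_image)
  qed (use assms in auto)
  then show ?thesis using sum.reindex[OF inj, of f] by simp
qed

lemma count_marked:
  assumes "p > 0" "a \<le> p" "n * p \<le> N"
  shows "(\<Sum>i=1..N. of_bool (marked p n a x i)) = n * a"
proof -
  let ?f = "\<lambda>i. of_bool ((x (i div p) + 1 + int i) mod int p < int a) :: nat"
  have "(\<Sum>i=1..N. of_bool (marked p n a x i)) = (\<Sum>i\<in>{1..n * p}. of_bool (marked p n a x i) :: nat)"
    using assms(1,3) by (intro sum.mono_neutral_right)
      (auto simp: marked_def block_def less_eq_div_iff_mult_less_eq div_less_iff_less_mult)
  also have "\<dots> = (\<Sum>i<n * p. ?f i)"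
    using assms(1)
    by (intro sum.reindex_bij_witness[of _ Suc "\<lambda>i. i - 1"])
      (auto simp: marked_def block_def div_less_iff_less_mult algebra_simps)
  also have "\<dots> = (\<Sum>b<n. sum ?f {b * p..<b * p + p})"
    by (rule sum.nat_group [symmetric])
  also have "\<dots> = (\<Sum>b<n. a)"
  proof (intro sum.cong refl)
    fix b
    have "sum ?f {b * p..<b * p + p} = (\<Sum>i\<in>{b * p..<b * p + p}. of_bool ((x b + 1 + int i) mod int p < int a))"
    proof (intro sum.cong refl)
      fix i assume "i \<in> {b * p..<b * p + p}"
      then have "i div p = b" by (intro div_nat_eqI) (auto simp: algebra_simps)
      then show "?f i = of_bool ((x b + 1 + int i) mod int p < int a)" by simp
    qed
    also have "\<dots> = (\<Sum>v\<in>{0..<int p}. of_bool (v < int a))"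
      by (rule sum_shift_mod[OF assms(1)])
    also have "\<dots> = card ({0..<int p} \<inter> {v. v < int a})" by simp
    also have "{0..<int p} \<inter> {v. v < int a} = {0..<int a}" using assms(2) by auto
    finally show "sum ?f {b * p..<b * p + p} = a" by simp
  qed
  finally show ?thesis by simp
qed

lemma finite_passigns: "finite (passigns N t)"
proof -
  have "passigns N t \<subseteq> (\<Union>A\<in>Pow {1..N}. {m. dom m = A \<and> ran m \<subseteq> UNIV})"
    unfolding passigns_def by auto
  then show ?thesis
  proof (rule finite_subset)
    show "finite (\<Union>A\<in>Pow {1..N}. {m :: passign. dom m = A \<and> ran m \<subseteq> UNIV})"
      by (intro finite_UN_I finite_set_of_finite_maps) (auto intro: finite_subset)
  qed
qed

context affine_system
begin

definition consistent :: "nat \<Rightarrow> passign \<Rightarrow> (nat \<Rightarrow> int) \<Rightarrow> bool" where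
  "consistent a f x \<longleftrightarrow> (\<forall>i\<in>dom f. f i = Some (marked p n a x i))"

definition psol :: "nat \<Rightarrow> passign \<Rightarrow> real" where
  "psol a f = Re (pexp (\<lambda>x. of_bool (consistent a f x)))"

lemma consistent_add:
  "of_bool (consistent a f x) * of_bool (consistent a g x)
     = (if agree f g then of_bool (consistent a (f ++ g) x) else (0::complex))"
proof (cases "agree f g")
  case True
  have "(f ++ g) i = g i" if "i \<in> dom g" for i using that by (simp add: map_add_dom_app_simps)
  moreover have "(f ++ g) i = f i" if "i \<in> dom f" for i
    using that True unfolding agree_def by (cases "i \<in> dom g") (auto simp: map_add_dom_app_simps)
  ultimately have "consistent a (f ++ g) x \<longleftrightarrow> consistent a f x \<and> consistent a g x"
    by (auto simp add: consistent_def ball_Un simp del: map_add_Some_iff)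
  then show ?thesis using True by simp
next
  case False
  then obtain i where "i \<in> dom f" "i \<in> dom g" "f i \<noteq> g i" by (auto simp: agree_def)
  then have "\<not> (consistent a f x \<and> consistent a g x)" unfolding consistent_def by metis
  then show ?thesis using False by simp
qed

lemma y2_psol:
  "y2 (psol a) f g = Re (pexp (\<lambda>x. of_bool (consistent a f x) * of_bool (consistent a g x)))"
proof (cases "agree f g")
  case True
  then show ?thesis by (simp only: consistent_add y2_def psol_def if_True)
next
  case False
  then show ?thesis using pexp_mult[of 0 "\<lambda>_. 0"] by (simp only: consistent_add y2_def if_False) simp
qed

lemma y3_psol:
  "y3 (psol a) f g h = Re (pexp (\<lambda>x. of_bool (consistent a f x) * of_bool (consistent a g x) * of_bool (consistent a h x)))"
proof (cases "agree f g")
  case True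
  then show ?thesis by (simp only: consistent_add y3_def y2_psol if_True)
next
  case False
  then show ?thesis using pexp_mult[of 0 "\<lambda>_. 0"] by (simp only: consistent_add y3_def if_False) simp
qed

lemma psol_empty: "psol a Map.empty = 1"
proof -
  have "pexp (\<lambda>x. of_bool (consistent a Map.empty x)) = pexp (\<lambda>x. root_char p (\<Sum>b<n. 0 * x b))"
    by (simp add: consistent_def)
  also have "\<dots> = pmoment (\<lambda>_. 0)" by (rule pexp_char)
  also have "\<dots> = root_char p (rhs (\<lambda>_ _. 0))"
    using derives_zero active_zero by (intro pmoment_eq) auto
  also have "\<dots> = 1" by (simp add: rhs_def)
  finally show ?thesis by (simp add: psol_def)
qed

lemma psd_y2_psol: "psd_on (passigns N t) (y2 (psol a))"
  unfolding psd_on_def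
proof (intro conjI ballI allI)
  fix f g show "y2 (psol a) f g = y2 (psol a) g f"
    by (simp add: y2_psol mult.commute)
next
  fix c :: "passign \<Rightarrow> real"
  let ?I = "passigns N t" and ?F = "\<lambda>f x. c f * of_bool (consistent a f x)"
  have bool_real: "complex_of_real (of_bool P) = of_bool P" for P by (cases P) auto
  have "(\<Sum>f\<in>?I. \<Sum>g\<in>?I. c f * y2 (psol a) f g * c g)
      = Re (\<Sum>f\<in>?I. \<Sum>g\<in>?I. of_real (c f * c g) * pexp (\<lambda>x. of_bool (consistent a f x) * of_bool (consistent a g x)))"
    by (simp add: y2_psol mult_ac)
  also have "\<dots> = Re (pexp (\<lambda>x. \<Sum>f\<in>?I. \<Sum>g\<in>?I. of_real (c f * c g) * (of_bool (consistent a f x) * of_bool (consistent a g x))))"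
    by (simp only: pexp_sum pexp_mult)
  also have "(\<lambda>x. \<Sum>f\<in>?I. \<Sum>g\<in>?I. of_real (c f * c g) * (of_bool (consistent a f x) * of_bool (consistent a g x)))
      = (\<lambda>x. complex_of_real ((\<Sum>f\<in>?I. ?F f x)\<^sup>2))"
    by (simp add: power2_eq_square sum_product mult_ac bool_real)
  also have "0 \<le> Re (pexp \<dots>)"
  proof (rule pexp_square_nonneg[where T = "\<lambda>f. block p ` dom f \<inter> {..<n}", OF finite_passigns])
    fix f assume "f \<in> passigns N t"
    then have f: "finite (dom f)" "card (dom f) \<le> t"
      using finite_subset[of "dom f" "{1..N}"] by (auto simp: passigns_def)
    have "card (block p ` dom f \<inter> {..<n}) \<le> card (block p ` dom f)"
      using f by (intro card_mono) auto
    also have "\<dots> \<le> card (dom f)" using f by (intro card_image_le)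
    finally show "block p ` dom f \<inter> {..<n} \<subseteq> {..<n} \<and> card (block p ` dom f \<inter> {..<n}) \<le> t"
      using f by auto
    fix x :: "nat \<Rightarrow> int"
    have "marked p n a (restrict x (block p ` dom f \<inter> {..<n})) i = marked p n a x i" if "i \<in> dom f" for i
      using that by (auto simp: marked_def)
    then show "?F f (restrict x (block p ` dom f \<inter> {..<n})) = ?F f x"
      by (simp add: consistent_def)
  qed
  finally show "0 \<le> (\<Sum>f\<in>?I. \<Sum>g\<in>?I. c f * y2 (psol a) f g * c g)" .
qed

lemma psol_nonneg:
  assumes "f \<in> passigns N t"
  shows "0 \<le> psol a f"
proof -
  let ?c = "\<lambda>g. if g = f then 1 else (0::real)"
  have "0 \<le> (\<Sum>g\<in>passigns N t. \<Sum>h\<in>passigns N t. ?c g * y2 (psol a) g h * ?c h)"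
    by (rule psd_y2_psol[unfolded psd_on_def, THEN conjunct2, rule_format])
  also have "\<dots> = y2 (psol a) f f"
    using assms finite_passigns by (simp add: if_distrib[of "\<lambda>c. c * _"] if_distrib[of "\<lambda>c. _ * c"] cong: if_cong)
  also have "\<dots> = psol a f" by (simp add: y2_def agree_def map_add_subsumed1)
  finally show ?thesis .
qed

lemma sum_y3_psol:
  assumes "a \<le> p" "n * p \<le> N"
  shows "(\<Sum>i=1..N. y3 (psol a) f g [i \<mapsto> True]) = real (n * a) * y2 (psol a) f g"
proof -
  have c: "consistent a [i \<mapsto> True] x \<longleftrightarrow> marked p n a x i" for i x by (simp add: consistent_def)
  have "(\<Sum>i=1..N. y3 (psol a) f g [i \<mapsto> True])
      = Re (pexp (\<lambda>x. \<Sum>i=1..N. of_bool (consistent a f x) * of_bool (consistent a g x) * of_bool (marked p n a x i)))"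
    by (simp only: y3_psol c pexp_sum Re_sum)
  also have "(\<lambda>x. \<Sum>i=1..N. of_bool (consistent a f x) * of_bool (consistent a g x) * of_bool (marked p n a x i))
      = (\<lambda>x. of_nat (n * a) * (of_bool (consistent a f x) * of_bool (consistent a g x)) :: complex)"
  proof
    fix x
    have "(\<Sum>i=1..N. of_bool (marked p n a x i)) = (of_nat (n * a) :: complex)"
      unfolding count_marked[OF p_pos assms, of x, symmetric] of_nat_sum of_nat_of_bool ..
    then show "(\<Sum>i=1..N. of_bool (consistent a f x) * of_bool (consistent a g x) * of_bool (marked p n a x i))
        = of_nat (n * a) * (of_bool (consistent a f x) * of_bool (consistent a g x) :: complex)"
      by (simp only: sum_distrib_left [symmetric] mult_ac)
  qed
  also have "Re (pexp \<dots>) = real (n * a) * y2 (psol a) f g"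
    by (simp only: pexp_mult y2_psol) simp
  finally show ?thesis .
qed

lemma psol_feasible:
  assumes "a \<le> p" "n * p \<le> N" "\<rho> * real N \<le> real (n * a)"
  shows "lasserre_feasible N \<rho> t (psol a)"
  unfolding lasserre_feasible_def
proof (intro conjI psol_empty psd_y2_psol)
  let ?I = "passigns N t" and ?d = "real (n * a) - \<rho> * real N"
  have eq: "(\<Sum>i=1..N. y3 (psol a) f g [i \<mapsto> True]) - \<rho> * real N * y2 (psol a) f g = ?d * y2 (psol a) f g" for f g
    by (simp only: sum_y3_psol[OF assms(1,2)] left_diff_distrib)
  have "(\<Sum>f\<in>?I. \<Sum>g\<in>?I. x f * (?d * y2 (psol a) f g) * x g)
      = ?d * (\<Sum>f\<in>?I. \<Sum>g\<in>?I. x f * y2 (psol a) f g * x g)" for x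
    by (simp add: sum_distrib_left mult_ac)
  moreover have "0 \<le> ?d" using assms(3) by simp
  ultimately show "psd_on ?I (\<lambda>f g. (\<Sum>i=1..N. y3 (psol a) f g [i \<mapsto> True]) - \<rho> * real N * y2 (psol a) f g)"
    using psd_y2_psol[of N a] unfolding eq psd_on_def by auto
qed

lemma psol_neighbours:
  assumes j: "j \<in> J" and a: "a \<le> p"
    and Sj: "S j = block p ` \<Gamma> \<inter> {..<n}"
    and s: "\<And>i. i \<in> \<Gamma> \<Longrightarrow> block p i < n \<Longrightarrow> s j (block p i) = - int i"
  shows "psol a ((\<lambda>_. Some False) |` \<Gamma>) \<ge> (real p - real a) / (real p)\<^sup>2"
proof -
  let ?f = "(\<lambda>_. Some False) |` \<Gamma>" and ?Z = "{0..<int p}"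
  let ?x = "\<lambda>\<alpha> \<beta> b. (s j b + \<alpha> + \<beta> * e j b) mod int p"
  have cons: "consistent a ?f x \<longleftrightarrow> (\<forall>i\<in>\<Gamma>. \<not> marked p n a x i)" for x
    by (auto simp: consistent_def)
  have "pexp (\<lambda>x. of_bool (consistent a ?f x)) =
      (\<Sum>\<alpha>\<in>?Z. \<Sum>\<beta>\<in>?Z. of_bool (consistent a ?f (?x \<alpha> \<beta>))) / (of_nat p)\<^sup>2"
    by (rule pexp_local[OF j]) (auto simp: cons marked_def Sj)
  also have "\<dots> = of_real ((\<Sum>\<alpha>\<in>?Z. \<Sum>\<beta>\<in>?Z. of_bool (consistent a ?f (?x \<alpha> \<beta>))) / (real p)\<^sup>2)"
    by simp
  finally have eq: "psol a ?f = (\<Sum>\<alpha>\<in>?Z. \<Sum>\<beta>\<in>?Z. of_bool (consistent a ?f (?x \<alpha> \<beta>))) / (real p)\<^sup>2"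
    unfolding psol_def by (simp only: Re_complex_of_real)
  have one: "consistent a ?f (?x \<alpha> 0)" if "\<alpha> \<in> {int a..<int p}" for \<alpha>
    using that by (auto simp: cons marked_def s mod_simps)
  have "real p - real a = (\<Sum>\<alpha>\<in>{int a..<int p}. 1)" using a by simp
  also have "\<dots> \<le> (\<Sum>\<alpha>\<in>{int a..<int p}. \<Sum>\<beta>\<in>?Z. of_bool (consistent a ?f (?x \<alpha> \<beta>)))"
  proof (rule sum_mono)
    fix \<alpha> assume "\<alpha> \<in> {int a..<int p}"
    then have "1 = (\<Sum>\<beta>\<in>{0::int}. of_bool (consistent a ?f (?x \<alpha> \<beta>)) :: real)" using one by simp
    also have "\<dots> \<le> (\<Sum>\<beta>\<in>?Z. of_bool (consistent a ?f (?x \<alpha> \<beta>)))"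
      using p_pos by (intro sum_mono2) auto
    finally show "(1::real) \<le> (\<Sum>\<beta>\<in>?Z. of_bool (consistent a ?f (?x \<alpha> \<beta>)))" .
  qed
  also have "\<dots> \<le> (\<Sum>\<alpha>\<in>?Z. \<Sum>\<beta>\<in>?Z. of_bool (consistent a ?f (?x \<alpha> \<beta>)))"
    by (intro sum_mono2) (auto intro: sum_nonneg)
  finally show ?thesis unfolding eq by (intro divide_right_mono) auto
qed

lemma lasserre_value_le:
  assumes a: "a \<le> p" and N: "n * p \<le> N" "\<rho> * real N \<le> real (n * a)"
    and JM: "J \<subseteq> {1..M}"
    and nb: "\<And>j. j \<in> {1..M} \<Longrightarrow> nbrs_right E j \<subseteq> {1..N} \<and> card (nbrs_right E j) \<le> t"
    and Sj: "\<And>j. j \<in> J \<Longrightarrow> S j = block p ` nbrs_right E j \<inter> {..<n}"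
    and s: "\<And>j i. j \<in> J \<Longrightarrow> i \<in> nbrs_right E j \<Longrightarrow> block p i < n \<Longrightarrow> s j (block p i) = - int i"
  shows "lasserre_value N M E \<rho> t \<le> ereal (real M - real (card J) * ((real p - real a) / (real p)\<^sup>2))"
proof -
  let ?y = "psol a" and ?v = "(real p - real a) / (real p)\<^sup>2"
  have "lasserre_value N M E \<rho> t \<le> ereal (lasserre_objective M E ?y)"
    unfolding lasserre_value_def using psol_feasible[OF a N] by (intro INF_lower) simp
  also have "lasserre_objective M E ?y \<le> (\<Sum>j=1..M. 1 - (if j \<in> J then ?v else 0))"
    unfolding lasserre_objective_def
  proof (rule sum_mono)
    fix j assume j: "j \<in> {1..M}"
    let ?f = "(\<lambda>_. Some False) |` nbrs_right E j"
    have "(if j \<in> J then ?v else 0) \<le> ?y ?f"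
    proof (cases "j \<in> J")
      case True
      then show ?thesis using psol_neighbours[OF True a Sj[OF True]] s by simp
    next
      case False
      have "?f \<in> passigns N t" using nb[OF j] by (auto simp: passigns_def)
      then show ?thesis using False psol_nonneg by simp
    qed
    then show "1 - ?y ?f \<le> 1 - (if j \<in> J then ?v else 0)" by simp
  qed
  also have "\<dots> = real M - (\<Sum>j\<in>{1..M}. if j \<in> J then ?v else 0)"
    by (simp add: sum_subtractf)
  also have "(\<Sum>j\<in>{1..M}. if j \<in> J then ?v else 0) = (\<Sum>j\<in>{1..M} \<inter> J. ?v)"
    by (rule sum.inter_restrict [symmetric]) simp
  also have "\<dots> = real (card J) * ?v" using JM by (simp add: Int_absorb1)
  finally show ?thesis by simp
qed

end

section \<open>Random choices\<close>

definition choices :: "nat \<Rightarrow> nat \<Rightarrow> nat \<Rightarrow> (nat \<times> nat \<Rightarrow> nat) pmf" where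
  "choices N M d = Pi_pmf ({1..M} \<times> {1..d}) 0 (\<lambda>_. pmf_of_set {1..N})"

lemma prob_Bex_le_sum:
  assumes "finite A" "\<And>a. a \<in> A \<Longrightarrow> measure_pmf.prob q {x. P a x} \<le> b a"
  shows "measure_pmf.prob q {x. \<exists>a\<in>A. P a x} \<le> (\<Sum>a\<in>A. b a)"
proof -
  have "{x. \<exists>a\<in>A. P a x} = (\<Union>a\<in>A. {x. P a x})" by auto
  then have "measure_pmf.prob q {x. \<exists>a\<in>A. P a x} \<le> (\<Sum>a\<in>A. measure_pmf.prob q {x. P a x})"
    using assms(1) by (simp add: measure_pmf.finite_measure_subadditive_finite)
  also have "\<dots> \<le> (\<Sum>a\<in>A. b a)" using assms by (intro sum_mono) auto
  finally show ?thesis .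
qed

lemma prob_Bex_le:
  assumes "finite A" "\<And>a. a \<in> A \<Longrightarrow> measure_pmf.prob q {x. P a x} \<le> b"
  shows "measure_pmf.prob q {x. \<exists>a\<in>A. P a x} \<le> real (card A) * b"
  using prob_Bex_le_sum[of A q P "\<lambda>_. b"] assms by simp

lemma prob_count_ge_le:
  assumes "finite A" "\<And>a. a \<in> A \<Longrightarrow> measure_pmf.prob q {x. P a x} \<le> b" "m > 0"
  shows "measure_pmf.prob q {x. m \<le> real (card {a\<in>A. P a x})} \<le> real (card A) * b / m"
proof -
  let ?f = "\<lambda>x. real (card {a\<in>A. P a x})"
  have f: "?f x = (\<Sum>a\<in>A. indicator {x. P a x} x)" for x
    using assms(1) by (simp add: indicator_def sum.If_cases Int_def)
  have int: "integrable q (\<lambda>x. indicator {x. P a x} x :: real)" for a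
    by (rule measure_pmf.integrable_const_bound[where B = 1]) (auto simp: indicator_def)
  have "measure_pmf.prob q {x. m \<le> ?f x} \<le> measure_pmf.expectation q ?f / m"
    using integral_Markov_inequality_measure[of q ?f "{}" m] assms(3) int by (simp add: f sum_nonneg)
  also have "measure_pmf.expectation q ?f = (\<Sum>a\<in>A. measure_pmf.prob q {x. P a x})"
    unfolding f using int by (subst Bochner_Integration.integral_sum) auto
  also have "\<dots> \<le> (\<Sum>a\<in>A. b)" using assms by (intro sum_mono) auto
  finally show ?thesis using assms(3) by (simp add: divide_right_mono)
qed

lemma prob_choices_le_prod:
  fixes g :: "nat \<times> nat \<Rightarrow> nat \<Rightarrow> real"
  assumes "N > 0" "c > 0" "\<And>q i. g q i \<ge> 0"
    and "\<And>h. h \<in> A \<Longrightarrow> c \<le> (\<Prod>q\<in>{1..M} \<times> {1..d}. g q (h q))"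
  shows "measure_pmf.prob (choices N M d) A \<le> (\<Prod>q\<in>{1..M} \<times> {1..d}. (\<Sum>i=1..N. g q i) / N) / c"
proof -
  let ?I = "{1..M} \<times> {1..d}"
  let ?q = "choices N M d"
  have fin: "finite (set_pmf ?q)"
    using assms(1) by (auto simp: choices_def set_Pi_pmf intro!: finite_PiE_dflt)
  have int: "integrable ?q f" for f :: "_ \<Rightarrow> real"
    by (rule integrable_measure_pmf_finite[OF fin])
  have "measure_pmf.prob ?q A = measure_pmf.expectation ?q (indicator A)" by simp
  also have "\<dots> \<le> measure_pmf.expectation ?q (\<lambda>h. (\<Prod>q\<in>?I. g q (h q)) / c)"
  proof (intro integral_mono int)
    fix h show "indicator A h \<le> (\<Prod>q\<in>?I. g q (h q)) / c"
      using assms(2-4) by (cases "h \<in> A") (auto simp: prod_nonneg)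
  qed
  also have "\<dots> = measure_pmf.expectation ?q (\<lambda>h. (\<Prod>q\<in>?I. g q (h q))) / c" by simp
  also have "measure_pmf.expectation ?q (\<lambda>h. (\<Prod>q\<in>?I. g q (h q)))
      = (\<Prod>q\<in>?I. measure_pmf.expectation (pmf_of_set {1..N}) (g q))"
    unfolding choices_def using assms by (intro expectation_prod_Pi_pmf integrable_measure_pmf_finite) auto
  also have "\<dots> = (\<Prod>q\<in>?I. (\<Sum>i=1..N. g q i) / N)"
    using assms(1) by (simp add: integral_pmf_of_set)
  finally show ?thesis .
qed

lemma choices_uniform:
  assumes "N > 0"
  shows "choices N M d = pmf_of_set (PiE_dflt ({1..M} \<times> {1..d}) 0 (\<lambda>_. {1..N}))"
  unfolding choices_def using assms by (intro Pi_pmf_of_set) auto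

text \<open>A choice is determined by its block and its residue, so on this event the values on \<open>Q\<close> are
  determined by the remaining values and \<open>card Q\<close> residues.\<close>

lemma prob_collisions:
  assumes "N > 0" "p > 0" and Q: "Q \<subseteq> {1..M} \<times> {1..d}" and \<phi>: "\<phi> \<in> Q \<rightarrow> {1..M} \<times> {1..d} - Q"
  shows "measure_pmf.prob (choices N M d) {h. \<forall>q\<in>Q. block p (h q) = block p (h (\<phi> q))} \<le> (real p / real N) ^ card Q"
proof -
  let ?I = "{1..M} \<times> {1..d}"
  let ?X = "PiE_dflt ?I 0 (\<lambda>_. {1..N})"
  let ?Y = "PiE_dflt ?I 0 (\<lambda>q. if q \<in> Q then {0..<p} else {1..N})"
  let ?A = "{h. \<forall>q\<in>Q. block p (h q) = block p (h (\<phi> q))}"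
  let ?g = "\<lambda>h q. if q \<in> Q then (h q - 1) mod p else h q"
  have finX: "finite ?X" by (intro finite_PiE_dflt) auto
  have finY: "finite ?Y" by (intro finite_PiE_dflt) auto
  have neX: "?X \<noteq> {}" using assms(1) by (auto simp: PiE_dflt_def intro!: exI[of _ "\<lambda>q. if q \<in> ?I then 1 else 0"] split: if_splits)
  have cX: "card ?X = N ^ card ?I" by (subst card_PiE_dflt) auto
  have "card ?Y = (\<Prod>q\<in>?I. if q \<in> Q then p else N)"
    by (subst card_PiE_dflt) (auto intro!: prod.cong)
  also have "\<dots> = p ^ card Q * N ^ card (?I - Q)"
    using Q by (subst prod.If_cases) (auto simp: Int_absorb1 Diff_eq)
  finally have cY: "card ?Y = p ^ card Q * N ^ card (?I - Q)" .
  have inj: "inj_on ?g (?X \<inter> ?A)"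
  proof (rule inj_onI)
    fix h h' assume h: "h \<in> ?X \<inter> ?A" and h': "h' \<in> ?X \<inter> ?A" and eq: "?g h = ?g h'"
    have out: "h q = h' q" if "q \<notin> Q" for q using fun_cong[OF eq, of q] that by simp
    show "h = h'"
    proof
      fix q show "h q = h' q"
      proof (cases "q \<in> Q")
        case True
        have "h (\<phi> q) = h' (\<phi> q)" using \<phi> True by (intro out) auto
        then have b: "(h q - 1) div p = (h' q - 1) div p" using h h' True by (simp add: block_def)
        have r: "(h q - 1) mod p = (h' q - 1) mod p" using fun_cong[OF eq, of q] True by simp
        have "h q - 1 = h' q - 1" using b r by (metis div_mult_mod_eq)
        moreover have "h q \<in> {1..N}" "h' q \<in> {1..N}" using h h' True Q by (auto simp: PiE_dflt_def)
        ultimately show ?thesis by auto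
      qed (rule out)
    qed
  qed
  have "card (?X \<inter> ?A) \<le> card ?Y"
  proof (rule card_inj_on_le[OF inj _ finY])
    show "?g ` (?X \<inter> ?A) \<subseteq> ?Y"
      using assms(2) Q by (auto simp: PiE_dflt_def subset_iff)
  qed
  also note cY
  finally have le: "real (card (?X \<inter> ?A)) \<le> real (p ^ card Q * N ^ card (?I - Q))"
    by (rule of_nat_mono)
  have "card ?I = card Q + card (?I - Q)"
    using card_Diff_subset[OF finite_subset[OF Q] Q] card_mono[OF _ Q] by simp
  then have cX': "card ?X = N ^ card Q * N ^ card (?I - Q)"
    using cX by (simp only: power_add)
  have "real (card (?X \<inter> ?A)) / real (card ?X)
      \<le> real (p ^ card Q * N ^ card (?I - Q)) / real (N ^ card Q * N ^ card (?I - Q))"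
    unfolding cX' using le by (rule divide_right_mono) simp
  also have "\<dots> = (real p / real N) ^ card Q"
    using assms(1) by (simp add: power_divide)
  finally have "real (card (?X \<inter> ?A)) / real (card ?X) \<le> (real p / real N) ^ card Q" .
  then show ?thesis
    unfolding choices_uniform[OF assms(1)] using finX neX by (simp add: measure_pmf_of_set)
qed

definition colliding :: "nat \<Rightarrow> nat \<Rightarrow> nat \<Rightarrow> (nat \<times> nat \<Rightarrow> nat) \<Rightarrow> nat \<Rightarrow> bool" where
  "colliding p M d h j \<longleftrightarrow>
     (\<exists>(l, m) \<in> {1..d} \<times> {1..d}. l \<noteq> m \<and> block p (h (j, l)) = block p (h (j, m))) \<or>
     (\<exists>(i, l, l', m, m') \<in> {1..M} \<times> {1..d} \<times> {1..d} \<times> {1..d} \<times> {1..d}. i \<noteq> j \<and> l \<noteq> l' \<and>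
        block p (h (j, l)) = block p (h (i, m)) \<and> block p (h (j, l')) = block p (h (i, m')))"

lemma prob_colliding:
  assumes "N > 0" "p > 0" "j \<in> {1..M}"
  shows "measure_pmf.prob (choices N M d) {h. colliding p M d h j}
    \<le> real d ^ 2 * (real p / real N) + real M * real d ^ 4 * (real p / real N) ^ 2"
proof -
  let ?q = "choices N M d"
  let ?P = "\<lambda>(l, m) h. l \<noteq> m \<and> block p (h (j, l)) = block p (h (j, m))"
  let ?R = "\<lambda>(i, l, l', m, m') h. i \<noteq> j \<and> l \<noteq> l' \<and>
        block p (h (j, l)) = block p (h (i, m)) \<and> block p (h (j, l')) = block p (h (i, m'))"
  let ?A = "{1..d} \<times> {1..d}" and ?B = "{1..M} \<times> {1..d} \<times> {1..d} \<times> {1..d} \<times> {1..d}"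
  have "measure_pmf.prob ?q {h. ?P a h} \<le> real p / real N" if a: "a \<in> ?A" for a
  proof -
    obtain l m where a': "a = (l, m)" "l \<in> {1..d}" "m \<in> {1..d}" using a by auto
    show ?thesis
    proof (cases "l = m")
      case False
      have "measure_pmf.prob ?q {h. ?P a h}
          \<le> measure_pmf.prob ?q {h. \<forall>q\<in>{(j, l)}. block p (h q) = block p (h ((\<lambda>_. (j, m)) q))}"
        using a' by (intro measure_pmf.finite_measure_mono) auto
      also have "\<dots> \<le> (real p / real N) ^ card {(j, l)}"
        using a' False assms by (intro prob_collisions) auto
      finally show ?thesis by simp
    qed (simp add: a')
  qed
  then have 1: "measure_pmf.prob ?q {h. \<exists>a\<in>?A. ?P a h} \<le> real (card ?A) * (real p / real N)"
    by (intro prob_Bex_le) auto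
  have "measure_pmf.prob ?q {h. ?R a h} \<le> (real p / real N) ^ 2" if a: "a \<in> ?B" for a
  proof -
    obtain i l l' m m' where a': "a = (i, l, l', m, m')" "i \<in> {1..M}" "l \<in> {1..d}" "l' \<in> {1..d}" "m \<in> {1..d}" "m' \<in> {1..d}"
      using a by auto
    show ?thesis
    proof (cases "i = j \<or> l = l'")
      case False
      let ?\<phi> = "\<lambda>q. if q = (j, l) then (i, m) else (i, m')"
      have "measure_pmf.prob ?q {h. ?R a h}
          \<le> measure_pmf.prob ?q {h. \<forall>q\<in>{(j, l), (j, l')}. block p (h q) = block p (h (?\<phi> q))}"
        using a' False by (intro measure_pmf.finite_measure_mono) auto
      also have "\<dots> \<le> (real p / real N) ^ card {(j, l), (j, l')}"
        using a' False assms by (intro prob_collisions) auto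
      also have "card {(j, l), (j, l')} = 2" using False by simp
      finally show ?thesis .
    qed (auto simp: a')
  qed
  then have 2: "measure_pmf.prob ?q {h. \<exists>a\<in>?B. ?R a h} \<le> real (card ?B) * (real p / real N) ^ 2"
    by (intro prob_Bex_le) auto
  have "{h. colliding p M d h j} = {h. \<exists>a\<in>?A. ?P a h} \<union> {h. \<exists>a\<in>?B. ?R a h}"
    unfolding colliding_def by auto
  then have "measure_pmf.prob ?q {h. colliding p M d h j}
      \<le> measure_pmf.prob ?q {h. \<exists>a\<in>?A. ?P a h} + measure_pmf.prob ?q {h. \<exists>a\<in>?B. ?R a h}"
    by (simp only:) (intro measure_Un_le; simp)
  also have "\<dots> \<le> real (card ?A) * (real p / real N) + real (card ?B) * (real p / real N) ^ 2"
    by (rule add_mono[OF 1 2])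
  also have "\<dots> = real d ^ 2 * (real p / real N) + real M * real d ^ 4 * (real p / real N) ^ 2"
    by (simp add: card_cartesian_product power2_eq_square power4_eq_xxxx)
  finally show ?thesis .
qed

lemma prob_undispersed:
  assumes "N > 0" "k \<le> N" "S \<subseteq> {1..N}" "card S = k" "K \<subseteq> {1..M}"
  shows "measure_pmf.prob (choices N M d) {h. \<forall>j\<in>K. \<forall>l\<in>{1..d}. h (j, l) \<notin> S} \<le> (1 - real k / real N) ^ (d * card K)"
proof -
  let ?I = "{1..M} \<times> {1..d}"
  let ?g = "\<lambda>q i. if q \<in> K \<times> {1..d} then of_bool (i \<notin> S) else 1 :: real"
  have "measure_pmf.prob (choices N M d) {h. \<forall>j\<in>K. \<forall>l\<in>{1..d}. h (j, l) \<notin> S} \<le> (\<Prod>q\<in>?I. (\<Sum>i=1..N. ?g q i) / N) / 1"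
    using assms(1) by (intro prob_choices_le_prod) (auto intro!: prod_ge_1)
  also have "\<dots> = (\<Prod>q\<in>?I. if q \<in> K \<times> {1..d} then 1 - real k / real N else 1)"
    unfolding div_by_1
  proof (intro prod.cong refl)
    fix q
    have "card ({1..N} \<inter> {i. i \<notin> S}) = N - k"
      using assms(3,4) by (simp add: Diff_eq [symmetric] Compl_eq [symmetric] card_Diff_subset finite_subset)
    then have "(\<Sum>i=1..N. of_bool (i \<notin> S)) = real N - real k" using assms(2) by simp
    then show "(\<Sum>i=1..N. ?g q i) / real N = (if q \<in> K \<times> {1..d} then 1 - real k / real N else 1)"
      using assms(1) by (simp add: diff_divide_distrib)
  qed
  also have "\<dots> = (1 - real k / real N) ^ card (K \<times> {1..d})"
    using assms(5) by (subst prod.If_cases) (auto simp: Int_absorb1 Times_subset_cancel2 Sigma_mono Int_absorb2)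
  also have "card (K \<times> {1..d}) = d * card K" by (simp add: card_cartesian_product mult.commute)
  finally show ?thesis .
qed

lemma prob_overloaded:
  assumes "N > 0" "n * p \<le> N" "p > 0" "K \<subseteq> {1..M}"
  shows "measure_pmf.prob (choices N M d) {h. \<forall>j\<in>K. p < card {l\<in>{1..d}. block p (h (j, l)) < n}}
    \<le> ((1 + real (n * p) / real N) ^ d / 2 ^ p) ^ card K"
proof -
  let ?I = "{1..M} \<times> {1..d}"
  let ?g = "\<lambda>q i. if q \<in> K \<times> {1..d} then (if block p i < n then 2 else 1) else 1 :: real"
  have finK: "finite K" using assms(4) finite_subset by blast
  have IK: "?I \<inter> K \<times> {1..d} = K \<times> {1..d}" using assms(4) by auto
  have "measure_pmf.prob (choices N M d) {h. \<forall>j\<in>K. p < card {l\<in>{1..d}. block p (h (j, l)) < n}}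
      \<le> (\<Prod>q\<in>?I. (\<Sum>i=1..N. ?g q i) / N) / 2 ^ (p * card K)"
  proof (rule prob_choices_le_prod)
    fix h assume h: "h \<in> {h. \<forall>j\<in>K. p < card {l\<in>{1..d}. block p (h (j, l)) < n}}"
    have "(2::real) ^ (p * card K) = (\<Prod>j\<in>K. 2 ^ p)" by (simp add: power_mult)
    also have "\<dots> \<le> (\<Prod>j\<in>K. \<Prod>l\<in>{1..d}. if block p (h (j, l)) < n then 2 else 1)"
    proof (intro prod_mono conjI)
      fix j assume "j \<in> K"
      then have "(2::real) ^ p \<le> 2 ^ card {l\<in>{1..d}. block p (h (j, l)) < n}"
        using h by (intro power_increasing) auto
      also have "\<dots> = (\<Prod>l\<in>{1..d}. if block p (h (j, l)) < n then 2 else 1)"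
        by (subst prod.If_cases) (auto simp: Int_def)
      finally show "(2::real) ^ p \<le> (\<Prod>l\<in>{1..d}. if block p (h (j, l)) < n then 2 else 1)" .
    qed simp
    also have "\<dots> = (\<Prod>q\<in>K \<times> {1..d}. if block p (h q) < n then 2 else 1)"
      by (simp add: prod.cartesian_product case_prod_beta)
    also have "\<dots> = (\<Prod>q\<in>?I \<inter> K \<times> {1..d}. if block p (h q) < n then 2 else 1)"
      by (simp only: IK)
    also have "\<dots> = (\<Prod>q\<in>?I. ?g q (h q))"
      by (rule prod.inter_restrict) simp
    finally show "(2::real) ^ (p * card K) \<le> (\<Prod>q\<in>?I. ?g q (h q))" .
  qed (use assms in auto)
  also have "(\<Prod>q\<in>?I. (\<Sum>i=1..N. ?g q i) / N) = (\<Prod>q\<in>?I. if q \<in> K \<times> {1..d} then 1 + real (n * p) / real N else 1)"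
  proof (intro prod.cong refl)
    fix q
    have "{1..N} \<inter> {i. block p i < n} = {1..n * p}"
      using assms(2,3) by (auto simp: block_def div_less_iff_less_mult)
    then have "card ({1..N} \<inter> {i. block p i < n}) = n * p" by simp
    moreover have "(\<Sum>i=1..N. if block p i < n then 2 else (1::real)) = (\<Sum>i=1..N. 1 + of_bool (block p i < n))"
      by (intro sum.cong) auto
    ultimately have "(\<Sum>i=1..N. if block p i < n then 2 else 1) = real N + real (n * p)"
      by (simp add: sum.distrib)
    then show "(\<Sum>i=1..N. ?g q i) / real N = (if q \<in> K \<times> {1..d} then 1 + real (n * p) / real N else 1)"
      using assms(1) by (simp add: add_divide_distrib)
  qed
  also have "\<dots> = (\<Prod>q\<in>?I \<inter> K \<times> {1..d}. 1 + real (n * p) / real N)"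
    by (rule prod.inter_restrict [symmetric]) simp
  also have "\<dots> = (1 + real (n * p) / real N) ^ (d * card K)"
    unfolding IK by (simp add: card_cartesian_product mult.commute)
  finally show ?thesis by (simp add: power_divide power_mult [symmetric])
qed

definition crowded :: "nat \<Rightarrow> nat \<Rightarrow> (nat \<times> nat \<Rightarrow> nat) \<Rightarrow> nat set \<Rightarrow> bool" where
  "crowded p d h K \<longleftrightarrow> 10 * card ((\<lambda>q. block p (h q)) ` (K \<times> {1..d})) + 11 * card K < 10 * (d * card K)"

text \<open>Choose one representative choice per block; \<open>Q\<close> consists of the remaining choices.\<close>

lemma crowded_witness:
  assumes "finite K" "crowded p d h K"
  obtains Q \<phi> where "Q \<subseteq> K \<times> {1..d}" "11 * card K \<le> 10 * card Q" "\<phi> \<in> PiE Q (\<lambda>_. K \<times> {1..d} - Q)"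
    "\<forall>q\<in>Q. block p (h q) = block p (h (\<phi> q))"
proof -
  let ?I = "K \<times> {1..d}" and ?f = "\<lambda>q. block p (h q)"
  define P where "P = inv_into ?I ?f ` ?f ` ?I"
  define Q where "Q = ?I - P"
  define \<phi> where "\<phi> = restrict (\<lambda>q. inv_into ?I ?f (?f q)) Q"
  have fin: "finite ?I" using assms(1) by simp
  have PI: "P \<subseteq> ?I"
  proof
    fix x assume "x \<in> P"
    then obtain q where "q \<in> ?I" "x = inv_into ?I ?f (?f q)" unfolding P_def by blast
    then show "x \<in> ?I" using inv_into_into[of "?f q" ?f ?I] by blast
  qed
  have cP: "card P = card (?f ` ?I)" unfolding P_def by (intro card_image inj_on_inv_into) simp
  have "card Q = d * card K - card (?f ` ?I)"
    unfolding Q_def using PI fin cP by (simp add: card_Diff_subset finite_subset card_cartesian_product mult.commute)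
  then have 1: "11 * card K \<le> 10 * card Q" using assms(2) unfolding crowded_def by linarith
  have 2: "\<phi> \<in> PiE Q (\<lambda>_. ?I - Q)"
  proof (rule PiE_I)
    fix q assume q: "q \<in> Q"
    then have "?f q \<in> ?f ` ?I" by (auto simp: Q_def simp del: mem_Sigma_iff)
    then have "\<phi> q \<in> P" using q unfolding \<phi>_def P_def restrict_def by (simp only: if_True) (rule imageI)
    then show "\<phi> q \<in> ?I - Q" using PI by (auto simp: Q_def simp del: mem_Sigma_iff)
  qed (simp add: \<phi>_def)
  have "?f q = ?f (\<phi> q)" if q: "q \<in> Q" for q
  proof -
    have "?f q \<in> ?f ` ?I" using q by (auto simp: Q_def simp del: mem_Sigma_iff)
    then have "?f (inv_into ?I ?f (?f q)) = ?f q" by (rule f_inv_into_f)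
    then show ?thesis using q by (simp add: \<phi>_def)
  qed
  then show ?thesis using that[of Q \<phi>] 1 2 by (simp add: Q_def)
qed

lemma prob_crowded:
  assumes "N > 0" "p > 0" "d > 0" "K \<subseteq> {1..M}" "card K = s" "s > 0" "d * s * p \<le> N"
  shows "measure_pmf.prob (choices N M d) {h. crowded p d h K}
    \<le> 2 ^ (d * s) * (real (d * s * p) / real N) powr (1.1 * real s)"
proof -
  let ?q = "choices N M d" and ?I = "K \<times> {1..d}"
  let ?x = "real (d * s * p) / real N"
  define QQ where "QQ = {Q \<in> Pow ?I. 11 * card K \<le> 10 * card Q}"
  have finK: "finite K" using assms(4) finite_subset by blast
  then have finI: "finite ?I" by simp
  have cI: "card ?I = d * s" using assms(5) by (simp add: card_cartesian_product mult.commute)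
  have finQQ: "finite QQ" using finI by (simp add: QQ_def)
  have cQQ: "card QQ \<le> 2 ^ (d * s)"
  proof -
    have "card QQ \<le> card (Pow ?I)" using finI by (intro card_mono) (auto simp: QQ_def)
    also have "\<dots> = 2 ^ (d * s)" using finI cI by (simp add: card_Pow)
    finally show ?thesis .
  qed
  have "real (d * s * p) \<le> real N" using assms(7) by (simp only: of_nat_le_iff)
  then have x: "0 \<le> ?x" "?x \<le> 1" using assms(1) by (auto simp: divide_le_eq_1 simp del: of_nat_mult)
  have xpos: "?x > 0" using assms by simp
  let ?P = "\<lambda>Q h. \<exists>\<phi>\<in>PiE Q (\<lambda>_. ?I - Q). \<forall>q\<in>Q. block p (h q) = block p (h (\<phi> q))"
  have "measure_pmf.prob ?q {h. ?P Q h} \<le> ?x powr (1.1 * real s)" if Q: "Q \<in> QQ" for Q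
  proof -
    have QI: "Q \<subseteq> ?I" and cQ: "11 * s \<le> 10 * card Q" using Q assms(5) by (auto simp: QQ_def)
    have finQ: "finite Q" using QI finI finite_subset by blast
    have II: "?I \<subseteq> {1..M} \<times> {1..d}" using assms(4) by auto
    have "measure_pmf.prob ?q {h. ?P Q h} \<le> real (card (PiE Q (\<lambda>_. ?I - Q))) * (real p / real N) ^ card Q"
    proof (rule prob_Bex_le)
      show "finite (PiE Q (\<lambda>_. ?I - Q))" using finQ finI by (intro finite_PiE) auto
      fix \<phi> assume \<phi>: "\<phi> \<in> PiE Q (\<lambda>_. ?I - Q)"
      then have "\<phi> \<in> Q \<rightarrow> {1..M} \<times> {1..d} - Q" using II by (auto simp: PiE_def Pi_def)
      then show "measure_pmf.prob ?q {h. \<forall>q\<in>Q. block p (h q) = block p (h (\<phi> q))} \<le> (real p / real N) ^ card Q"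
        using assms QI II by (intro prob_collisions) auto
    qed
    also have "card (PiE Q (\<lambda>_. ?I - Q)) = card (?I - Q) ^ card Q" using finQ by (simp add: card_PiE)
    also have "real (card (?I - Q) ^ card Q) * (real p / real N) ^ card Q \<le> real ((d * s) ^ card Q) * (real p / real N) ^ card Q"
    proof (intro mult_right_mono of_nat_mono power_mono)
      show "card (?I - Q) \<le> d * s" unfolding cI [symmetric] using finI by (intro card_mono) auto
    qed auto
    also have "\<dots> = ?x ^ card Q" by (simp add: power_mult_distrib power_divide)
    also have "\<dots> = ?x powr real (card Q)" using xpos by (simp only: powr_realpow)
    also have "\<dots> \<le> ?x powr (1.1 * real s)"
    proof (rule powr_mono')
      have "real (11 * s) \<le> real (10 * card Q)" using cQ by (rule of_nat_mono)
      then show "1.1 * real s \<le> real (card Q)" by simp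
    qed (use x in auto)
    finally show ?thesis .
  qed
  then have "measure_pmf.prob ?q {h. \<exists>Q\<in>QQ. ?P Q h} \<le> real (card QQ) * ?x powr (1.1 * real s)"
    by (intro prob_Bex_le finQQ)
  also have "\<dots> \<le> 2 ^ (d * s) * ?x powr (1.1 * real s)"
    using of_nat_mono[OF cQQ, where 'a = real] by (intro mult_right_mono) auto
  finally have bound: "measure_pmf.prob ?q {h. \<exists>Q\<in>QQ. ?P Q h} \<le> 2 ^ (d * s) * ?x powr (1.1 * real s)" .
  have "{h. crowded p d h K} \<subseteq> {h. \<exists>Q\<in>QQ. ?P Q h}"
  proof
    fix h assume "h \<in> {h. crowded p d h K}"
    then have "crowded p d h K" by simp
    from crowded_witness[OF finK this] obtain Q \<phi> where "Q \<subseteq> ?I" "11 * card K \<le> 10 * card Q"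
      "\<phi> \<in> PiE Q (\<lambda>_. ?I - Q)" "\<forall>q\<in>Q. block p (h q) = block p (h (\<phi> q))" .
    then show "h \<in> {h. \<exists>Q\<in>QQ. ?P Q h}" unfolding QQ_def by blast
  qed
  then have "measure_pmf.prob ?q {h. crowded p d h K} \<le> measure_pmf.prob ?q {h. \<exists>Q\<in>QQ. ?P Q h}"
    by (intro measure_pmf.finite_measure_mono) auto
  then show ?thesis using bound by linarith
qed

lemma power_self_le_fact: "real s ^ s \<le> 3 ^ s * fact s"
proof -
  have "real s ^ s /\<^sub>R fact s \<le> exp (real s)"
  proof -
    have "(\<Sum>k\<in>{s}. real s ^ k /\<^sub>R fact k) \<le> (\<Sum>k. real s ^ k /\<^sub>R fact k)"
      using exp_converges[of "real s"] by (intro sum_le_suminf) (auto simp: sums_iff)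
    then show ?thesis using exp_converges[of "real s"] by (simp add: sums_iff)
  qed
  also have "exp (real s) = exp 1 ^ s" by (simp add: exp_of_nat_mult [symmetric])
  also have "\<dots> \<le> 3 ^ s" using exp_le by (intro power_mono) auto
  finally show ?thesis by (simp add: field_simps)
qed

lemma binomial_le_power:
  assumes "s > 0"
  shows "real (N choose s) \<le> (3 * real N / real s) ^ s"
proof -
  have "real (N choose s) * fact s \<le> real N ^ s"
    using binomial_fact_pow[of N s] by (metis of_nat_fact of_nat_le_iff of_nat_mult of_nat_power)
  then have "real (N choose s) * real s ^ s \<le> real (N choose s) * (3 ^ s * fact s)"
    by (intro mult_left_mono power_self_le_fact) auto
  also have "\<dots> \<le> 3 ^ s * real N ^ s"
    using \<open>real (N choose s) * fact s \<le> real N ^ s\<close> by (simp add: mult.left_commute)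
  finally show ?thesis using assms by (simp add: power_mult_distrib power_divide field_simps)
qed

lemma sum_arith_geometric_le: "(\<Sum>s=1..m. real s * (1 / 2) ^ (s - 1)) \<le> 4"
proof -
  have "(\<Sum>s=1..m. real s * (1 / 2) ^ (s - 1)) = 4 - 2 * (real m + 2) * (1 / 2) ^ m"
  proof (induction m)
    case (Suc m)
    have eq: "4 - 2 * (x + 2) * z + (x + 1) * z = 4 - 2 * ((x + 1) + 2) * (1 / 2 * z)" for x z :: real
      by (simp add: field_simps)
    have "(\<Sum>s=1..Suc m. real s * (1 / 2) ^ (s - 1)) = 4 - 2 * (real m + 2) * (1 / 2) ^ m + (real m + 1) * (1 / 2) ^ m"
      using Suc by simp
    then show ?case unfolding eq by (simp add: add.commute)
  qed simp
  then show ?thesis by simp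
qed

lemma prob_exists_crowded:
  fixes \<alpha> K0 :: real and d p :: nat
  defines "K0 \<equiv> 3 * 2 ^ d * real (d * p) powr 1.1"
  assumes "N > 0" "p > 0" "d > 0" "\<alpha> > 0" "real (d * p) * \<alpha> \<le> 1" "K0 * \<alpha> powr 0.1 \<le> 1 / 2"
  shows "measure_pmf.prob (choices N N d) {h. \<exists>K. K \<subseteq> {1..N} \<and> K \<noteq> {} \<and> real (card K) \<le> \<alpha> * real N \<and> crowded p d h K}
    \<le> 4 * K0 * real N powr - 0.1"
proof -
  let ?q = "choices N N d"
  define m where "m = nat \<lfloor>\<alpha> * real N\<rfloor>"
  define KK where "KK = (\<lambda>s. {K. K \<subseteq> {1..N} \<and> card K = s})"
  have K0: "K0 \<ge> 0" by (simp add: K0_def)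
  have term_le: "measure_pmf.prob ?q {h. \<exists>K\<in>KK s. crowded p d h K} \<le> K0 * real N powr - 0.1 * (real s * (1 / 2) ^ (s - 1))"
    if s: "s \<in> {1..m}" for s
  proof -
    define u where "u = real s / real N"
    have sN: "real s \<le> \<alpha> * real N" using s assms(2,5) by (simp add: m_def le_nat_iff le_floor_iff)
    have u: "u > 0" "u \<le> \<alpha>" using s sN assms(2) by (auto simp: u_def field_simps)
    have pos: "(real (d * p) * u) powr 1.1 > 0" using u assms by simp
    have "real (d * s * p) \<le> real (d * p) * (\<alpha> * real N)"
      using mult_left_mono[OF sN, of "real (d * p)"] by (simp add: mult_ac)
    also have "\<dots> \<le> 1 * real N" using mult_right_mono[OF assms(6), of "real N"] by (simp add: mult_ac)
    finally have "real (d * s * p) \<le> real N" by simp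
    then have dsp: "d * s * p \<le> N" by (simp only: of_nat_le_iff)
    have "measure_pmf.prob ?q {h. \<exists>K\<in>KK s. crowded p d h K}
        \<le> real (card (KK s)) * (2 ^ (d * s) * (real (d * s * p) / real N) powr (1.1 * real s))"
      using s dsp assms by (intro prob_Bex_le prob_crowded) (auto simp: KK_def)
    also have "card (KK s) = N choose s" using n_subsets[of "{1..N}" s] by (simp add: KK_def)
    also have "real (N choose s) * (2 ^ (d * s) * (real (d * s * p) / real N) powr (1.1 * real s))
        \<le> (3 * real N / real s) ^ s * (2 ^ (d * s) * (real (d * s * p) / real N) powr (1.1 * real s))"
      using s by (intro mult_right_mono binomial_le_power) auto
    also have "3 * real N / real s = 3 / u" by (simp add: u_def)
    also have "real (d * s * p) / real N = real (d * p) * u" by (simp add: u_def)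
    also have "(real (d * p) * u) powr (1.1 * real s) = ((real (d * p) * u) powr 1.1) ^ s"
      by (simp only: powr_powr [symmetric] powr_realpow[OF pos])
    also have "(3 / u) ^ s * (2 ^ (d * s) * ((real (d * p) * u) powr 1.1) ^ s) = (3 / u * (2 ^ d * (real (d * p) * u) powr 1.1)) ^ s"
      by (simp only: power_mult_distrib power_mult)
    also have "(real (d * p) * u) powr 1.1 = real (d * p) powr 1.1 * (u powr 0.1 * u)"
    proof -
      have "u powr 1.1 = u powr (0.1 + 1)" by simp
      also have "\<dots> = u powr 0.1 * u" using u by (simp only: powr_add) simp
      finally show ?thesis using u by (simp add: powr_mult)
    qed
    also have "3 / u * (2 ^ d * (real (d * p) powr 1.1 * (u powr 0.1 * u))) = K0 * u powr 0.1"
      using u by (simp add: K0_def)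
    also have "(K0 * u powr 0.1) ^ s = (K0 * u powr 0.1) * (K0 * u powr 0.1) ^ (s - 1)"
      using s by (subst power_eq_if) simp
    also have "\<dots> \<le> (K0 * u powr 0.1) * (1 / 2) ^ (s - 1)"
    proof (intro mult_left_mono power_mono)
      have "K0 * u powr 0.1 \<le> K0 * \<alpha> powr 0.1" using u K0 by (intro mult_left_mono powr_mono2) auto
      then show "K0 * u powr 0.1 \<le> 1 / 2" using assms(7) by linarith
    qed (use K0 in auto)
    also have "\<dots> \<le> (K0 * (real s * real N powr - 0.1)) * (1 / 2) ^ (s - 1)"
    proof (intro mult_right_mono mult_left_mono)
      have "u powr 0.1 = real s powr 0.1 * real N powr - 0.1"
        using s assms(2) by (simp add: u_def powr_divide powr_minus_divide)
      also have "\<dots> \<le> real s powr 1 * real N powr - 0.1"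
        using s by (intro mult_right_mono powr_mono) auto
      finally show "u powr 0.1 \<le> real s * real N powr - 0.1" using s by simp
    qed (use K0 in auto)
    finally show ?thesis by (simp add: mult_ac)
  qed
  have "measure_pmf.prob ?q {h. \<exists>K. K \<subseteq> {1..N} \<and> K \<noteq> {} \<and> real (card K) \<le> \<alpha> * real N \<and> crowded p d h K}
      \<le> measure_pmf.prob ?q {h. \<exists>s\<in>{1..m}. \<exists>K\<in>KK s. crowded p d h K}"
  proof (intro measure_pmf.finite_measure_mono subsetI)
    fix h assume "h \<in> {h. \<exists>K. K \<subseteq> {1..N} \<and> K \<noteq> {} \<and> real (card K) \<le> \<alpha> * real N \<and> crowded p d h K}"
    then obtain K where K: "K \<subseteq> {1..N}" "K \<noteq> {}" "real (card K) \<le> \<alpha> * real N" "crowded p d h K" by auto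
    have "finite K" using K(1) finite_subset by blast
    then have "card K \<in> {1..m}" using K by (auto simp: m_def le_nat_floor Suc_le_eq card_gt_0_iff)
    then show "h \<in> {h. \<exists>s\<in>{1..m}. \<exists>K\<in>KK s. crowded p d h K}" using K by (auto simp: KK_def)
  qed simp
  also have "\<dots> \<le> (\<Sum>s\<in>{1..m}. K0 * real N powr - 0.1 * (real s * (1 / 2) ^ (s - 1)))"
    by (intro prob_Bex_le_sum term_le) auto
  also have "\<dots> = K0 * real N powr - 0.1 * (\<Sum>s=1..m. real s * (1 / 2) ^ (s - 1))"
    by (simp add: sum_distrib_left)
  also have "\<dots> \<le> K0 * real N powr - 0.1 * 4"
    using K0 by (intro mult_left_mono sum_arith_geometric_le) auto
  finally show ?thesis by (simp add: mult_ac)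
qed

section \<open>Random graphs\<close>

definition edges :: "nat \<Rightarrow> nat \<Rightarrow> (nat \<times> nat \<Rightarrow> nat) \<Rightarrow> (nat \<times> nat) set" where
  "edges M d h = {(h (j, l), j) | j l. j \<in> {1..M} \<and> l \<in> {1..d}}"

lemma random_bipartite_eq: "random_bipartite N M d = map_pmf (edges M d) (choices N M d)"
  unfolding random_bipartite_def choices_def edges_def ..

lemma nbrs_right_edges: "j \<in> {1..M} \<Longrightarrow> nbrs_right (edges M d h) j = (\<lambda>l. h (j, l)) ` {1..d}"
  unfolding nbrs_right_def edges_def by auto

lemma lasserre_value_edges:
  assumes p: "prime p" and a: "a \<le> p" and N: "n * p \<le> N" "\<rho> * real N \<le> real (n * a)"
    and t_ge: "t \<ge> 1" "d \<le> t"
    and h: "\<And>j l. j \<in> {1..M} \<Longrightarrow> l \<in> {1..d} \<Longrightarrow> h (j, l) \<in> {1..N}"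
    and uncrowded: "\<And>K. K \<subseteq> {1..M} \<Longrightarrow> K \<noteq> {} \<Longrightarrow> card K \<le> 6 * t \<Longrightarrow> \<not> crowded p d h K"
    and few_over: "real (card {j\<in>{1..M}. p < card {l\<in>{1..d}. block p (h (j, l)) < n}}) \<le> 1 / 20 * real M"
    and few_coll: "real (card {j\<in>{1..M}. colliding p M d h j}) \<le> 1 / 20 * real M"
  shows "lasserre_value N M (edges M d h) \<rho> t \<le> ereal (real M - 0.9 * real M * ((real p - real a) / (real p)\<^sup>2))"
proof -
  let ?E = "edges M d h"
  define \<Gamma> where "\<Gamma> = (\<lambda>j. nbrs_right ?E j)"
  define V where "V = {j\<in>{1..M}. p < card {l\<in>{1..d}. block p (h (j, l)) < n}}"
  define C where "C = {j\<in>{1..M}. colliding p M d h j}"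
  define J where "J = {1..M} - (V \<union> C)"
  define S where "S = (\<lambda>j. block p ` \<Gamma> j \<inter> {..<n})"
  have \<Gamma>: "\<Gamma> j = (\<lambda>l. h (j, l)) ` {1..d}" if "j \<in> {1..M}" for j
    using that by (simp add: \<Gamma>_def nbrs_right_edges)
  have JM: "J \<subseteq> {1..M}" by (auto simp: J_def)
  have fin\<Gamma>: "finite (\<Gamma> j)" if "j \<in> {1..M}" for j using that by (simp add: \<Gamma>)
  have card_image_blocks: "card (block p ` \<Gamma> j) \<le> d" if "j \<in> {1..M}" for j
  proof -
    have "card (block p ` \<Gamma> j) = card ((\<lambda>l. block p (h (j, l))) ` {1..d})"
      using that by (simp add: \<Gamma> image_image)
    also have "\<dots> \<le> card {1..d}" by (intro card_image_le) simp
    finally show ?thesis by simp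
  qed
  have inj_l: "l = m" if "j \<in> J" "l \<in> {1..d}" "m \<in> {1..d}" "block p (h (j, l)) = block p (h (j, m))" for j l m
  proof (rule ccontr)
    assume "l \<noteq> m"
    then have "colliding p M d h j"
      unfolding colliding_def using that by (intro disjI1 bexI[of _ "(l, m)"]) auto
    then show False using that(1) by (auto simp: J_def C_def)
  qed
  have inj: "inj_on (block p) (\<Gamma> j)" if "j \<in> J" for j
  proof (rule inj_onI)
    fix x y assume xy: "x \<in> \<Gamma> j" "y \<in> \<Gamma> j" "block p x = block p y"
    have "j \<in> {1..M}" using that JM by blast
    then obtain l m where lm: "l \<in> {1..d}" "m \<in> {1..d}" "x = h (j, l)" "y = h (j, m)"
      using xy by (auto simp: \<Gamma>)
    have "l = m" by (rule inj_l[OF that lm(1,2)]) (use xy(3) lm(3,4) in simp)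
    then show "x = y" using lm by simp
  qed
  have cardS: "card (S j) \<le> p" if "j \<in> J" for j
  proof -
    have jM: "j \<in> {1..M}" using that JM by blast
    have "S j \<subseteq> (\<lambda>l. block p (h (j, l))) ` {l\<in>{1..d}. block p (h (j, l)) < n}"
      unfolding S_def \<Gamma>[OF jM] by auto
    then have "card (S j) \<le> card ((\<lambda>l. block p (h (j, l))) ` {l\<in>{1..d}. block p (h (j, l)) < n})"
      by (intro card_mono) auto
    also have "\<dots> \<le> card {l\<in>{1..d}. block p (h (j, l)) < n}" by (intro card_image_le) simp
    also have "\<dots> \<le> p" using that jM by (auto simp: J_def V_def)
    finally show ?thesis .
  qed
  have "\<exists>f. f ` S j \<subseteq> {0..<int p} \<and> inj_on f (S j)" if "j \<in> J" for j
    using cardS[OF that] by (intro card_le_inj) (auto simp: S_def)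
  then have "\<exists>e. \<forall>j\<in>J. e j ` S j \<subseteq> {0..<int p} \<and> inj_on (e j) (S j)"
    by (intro bchoice ballI)
  then obtain e where e: "\<And>j. j \<in> J \<Longrightarrow> e j ` S j \<subseteq> {0..<int p} \<and> inj_on (e j) (S j)" by blast
  define s where "s = (\<lambda>j b. - int (inv_into (\<Gamma> j) (block p) b))"
  interpret affine_system p n t J S e s
  proof
    show "prime p" by (rule p)
    show "finite J" using JM finite_subset by blast
    show "S j \<subseteq> {..<n}" for j by (auto simp: S_def)
    show "e j b \<in> {0..<int p}" if "j \<in> J" "b \<in> S j" for j b using e that by blast
    show "inj_on (e j) (S j)" if "j \<in> J" for j using e that by blast
    show "1 \<le> t" by (rule t_ge)
    show "card (S i \<inter> S j) \<le> 1" if ij: "i \<in> J" "j \<in> J" "i \<noteq> j" for i j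
    proof (rule ccontr)
      assume "\<not> card (S i \<inter> S j) \<le> 1"
      moreover have "finite (S i \<inter> S j)" by (simp add: S_def)
      ultimately obtain b c where bc: "b \<in> S i \<inter> S j" "c \<in> S i \<inter> S j" "b \<noteq> c"
        using card_le_Suc0_iff_eq[of "S i \<inter> S j"] by auto
      have iM: "i \<in> {1..M}" and jM: "j \<in> {1..M}" using ij JM by auto
      obtain l l' where l: "l \<in> {1..d}" "l' \<in> {1..d}" "b = block p (h (j, l))" "c = block p (h (j, l'))"
        using bc unfolding S_def \<Gamma>[OF jM] by auto
      obtain m m' where m: "m \<in> {1..d}" "m' \<in> {1..d}" "b = block p (h (i, m))" "c = block p (h (i, m'))"
        using bc unfolding S_def \<Gamma>[OF iM] by auto
      have "l \<noteq> l'" using l bc by auto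
      then have "colliding p M d h j"
        unfolding colliding_def using l m iM ij(3)
        by (intro disjI2 bexI[of _ "(i, l, l', m, m')"]) auto
      then show False using ij(2) by (auto simp: J_def C_def)
    qed
    show "10 * (\<Sum>j\<in>K. card (S j)) \<le> 10 * card (\<Union>j\<in>K. S j) + 11 * card K" if K: "K \<subseteq> J" "card K \<le> 6 * t" for K
    proof (cases "K = {}")
      case False
      have KM: "K \<subseteq> {1..M}" using K JM by auto
      then have finK: "finite K" using finite_subset by blast
      have "\<not> crowded p d h K" using uncrowded[OF KM False K(2)] .
      moreover have "(\<lambda>q. block p (h q)) ` (K \<times> {1..d}) = (\<Union>j\<in>K. block p ` \<Gamma> j)"
      proof -
        have "(\<Union>j\<in>K. block p ` \<Gamma> j) = (\<Union>j\<in>K. (\<lambda>l. block p (h (j, l))) ` {1..d})"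
          using KM by (intro SUP_cong refl) (auto simp: \<Gamma> image_image subset_iff)
        then show ?thesis by auto
      qed
      ultimately have 1: "10 * (d * card K) \<le> 10 * card (\<Union>j\<in>K. block p ` \<Gamma> j) + 11 * card K"
        unfolding crowded_def by simp
      have 2: "(\<Sum>j\<in>K. card (S j)) + card (\<Union>j\<in>K. block p ` \<Gamma> j)
          \<le> (\<Sum>j\<in>K. card (block p ` \<Gamma> j)) + card (\<Union>j\<in>K. S j)"
        using finK KM fin\<Gamma> by (intro excess_mono) (auto simp: S_def)
      have 3: "(\<Sum>j\<in>K. card (block p ` \<Gamma> j)) \<le> d * card K"
        using sum_bounded_above[of K "\<lambda>j. card (block p ` \<Gamma> j)" d] card_image_blocks KM
        by (simp add: subset_iff mult.commute)
      show ?thesis using 1 2 3 by linarith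
    qed simp
  qed
  have val: "lasserre_value N M ?E \<rho> t \<le> ereal (real M - real (card J) * ((real p - real a) / (real p)\<^sup>2))"
  proof (rule lasserre_value_le[OF a N JM])
    fix j assume j: "j \<in> {1..M}"
    have "card (\<Gamma> j) \<le> card {1..d}" unfolding \<Gamma>[OF j] by (intro card_image_le) simp
    then show "nbrs_right ?E j \<subseteq> {1..N} \<and> card (nbrs_right ?E j) \<le> t"
      using t_ge(2) h j \<Gamma>[OF j] by (auto simp: \<Gamma>_def)
  next
    show "S j = block p ` nbrs_right ?E j \<inter> {..<n}" for j by (simp add: S_def \<Gamma>_def)
  next
    fix j i assume "j \<in> J" "i \<in> nbrs_right ?E j"
    then show "s j (block p i) = - int i" using inj[of j] by (simp add: s_def \<Gamma>_def)
  qed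
  have "card J = M - card (V \<union> C)"
    unfolding J_def by (subst card_Diff_subset) (auto simp: V_def C_def)
  moreover have "card (V \<union> C) \<le> card V + card C" by (rule card_Un_le)
  ultimately have "0.9 * real M \<le> real (card J)"
    using few_over few_coll unfolding V_def [symmetric] C_def [symmetric] by linarith
  then have "0.9 * real M * ((real p - real a) / (real p)\<^sup>2) \<le> real (card J) * ((real p - real a) / (real p)\<^sup>2)"
    using a by (intro mult_right_mono) auto
  then have "ereal (real M - real (card J) * ((real p - real a) / (real p)\<^sup>2))
      \<le> ereal (real M - 0.9 * real M * ((real p - real a) / (real p)\<^sup>2))"
    by simp
  with val show ?thesis by (rule order_trans)
qed

lemma disperser_edges:
  assumes h: "\<And>j l. j \<in> {1..M} \<Longrightarrow> l \<in> {1..d} \<Longrightarrow> h (j, l) \<in> {1..N}" and x: "x \<ge> 0"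
    and hit: "\<And>S K. S \<subseteq> {1..N} \<Longrightarrow> card S = k \<Longrightarrow> K \<subseteq> {1..M} \<Longrightarrow> \<epsilon> * real M \<le> real (card K) \<Longrightarrow>
       \<exists>j\<in>K. \<exists>l\<in>{1..d}. h (j, l) \<in> S"
  shows "disperser N M (edges M d h) k ((1 - x - \<epsilon>) * real M)"
  unfolding disperser_def
proof (intro conjI allI impI)
  show "bipartite_graph N M (edges M d h)"
    using h by (auto simp: bipartite_graph_def edges_def)
  fix S assume S: "S \<subseteq> {1..N} \<and> card S = k"
  define K where "K = {1..M} - nbrs_left (edges M d h) S"
  have sub: "nbrs_left (edges M d h) S \<subseteq> {1..M}" by (auto simp: nbrs_left_def edges_def)
  have "\<not> (\<exists>j\<in>K. \<exists>l\<in>{1..d}. h (j, l) \<in> S)"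
    by (auto simp: K_def nbrs_left_def edges_def)
  then have "real (card K) < \<epsilon> * real M"
    using hit[of S K] S by (force simp: K_def)
  moreover have "card K = M - card (nbrs_left (edges M d h) S)"
    unfolding K_def using sub by (subst card_Diff_subset) (auto intro: finite_subset)
  ultimately have "real M - real (card (nbrs_left (edges M d h) S)) < \<epsilon> * real M" by linarith
  moreover have "0 \<le> x * real M" using x by simp
  ultimately show "(1 - x - \<epsilon>) * real M \<le> real (card (nbrs_left (edges M d h) S))"
    by (simp add: left_diff_distrib)
qed

lemma prob_exists_undispersed:
  assumes "N > 0" "0 < \<rho>" "\<rho> < 1" "\<epsilon> > 0" "k \<le> N" "\<rho> / 2 \<le> real k / real N"
    and c: "(1 - \<rho> / 2) powr (real d * \<epsilon>) \<le> 1 / 8"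
  shows "measure_pmf.prob (choices N N d) {h. \<exists>S K. S \<subseteq> {1..N} \<and> card S = k \<and> K \<subseteq> {1..N} \<and>
      \<epsilon> * real N \<le> real (card K) \<and> (\<forall>j\<in>K. \<forall>l\<in>{1..d}. h (j, l) \<notin> S)} \<le> (1 / 2) ^ N"
proof -
  let ?q = "choices N N d"
  let ?A = "{(S, K). S \<subseteq> {1..N} \<and> card S = k \<and> K \<subseteq> {1..N} \<and> \<epsilon> * real N \<le> real (card K)}"
  let ?P = "\<lambda>(S, K) h. \<forall>j\<in>K. \<forall>l\<in>{1..d}. h (j, l) \<notin> S"
  have sub: "?A \<subseteq> Pow {1..N} \<times> Pow {1..N}" by auto
  have fin: "finite ?A" by (rule finite_subset[OF sub]) auto
  have "card ?A \<le> card (Pow {1..N} \<times> Pow {1..N})" by (rule card_mono[OF _ sub]) auto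
  also have "\<dots> = 2 ^ N * 2 ^ N" by (simp add: card_cartesian_product card_Pow)
  also have "\<dots> = (2 * 2) ^ N" by (rule power_mult_distrib [symmetric])
  also have "\<dots> = 4 ^ N" by simp
  finally have "real (card ?A) \<le> real (4 ^ N)" by (rule of_nat_mono)
  then have cA: "real (card ?A) \<le> 4 ^ N" by simp
  have one: "measure_pmf.prob ?q {h. ?P x h} \<le> (1 / 8) ^ N" if x: "x \<in> ?A" for x
  proof -
    obtain S K where SK: "x = (S, K)" "S \<subseteq> {1..N}" "card S = k" "K \<subseteq> {1..N}" "\<epsilon> * real N \<le> real (card K)"
      using x by auto
    have "measure_pmf.prob ?q {h. ?P x h} \<le> (1 - real k / real N) ^ (d * card K)"
      using prob_undispersed[OF assms(1,5) SK(2-4)] SK(1) by simp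
    also have "\<dots> \<le> (1 - \<rho> / 2) ^ (d * card K)"
      using assms by (intro power_mono) (auto simp: field_simps)
    also have "\<dots> = (1 - \<rho> / 2) powr real (d * card K)"
      using assms by (intro powr_realpow [symmetric]) auto
    also have "\<dots> \<le> (1 - \<rho> / 2) powr (real d * \<epsilon> * real N)"
    proof (rule powr_mono')
      show "real d * \<epsilon> * real N \<le> real (d * card K)"
        using mult_left_mono[OF SK(5), of "real d"] by (simp add: mult_ac)
    qed (use assms in auto)
    also have "\<dots> = ((1 - \<rho> / 2) powr (real d * \<epsilon>)) ^ N"
    proof -
      have "(1 - \<rho> / 2) powr (real d * \<epsilon>) > 0" using assms by simp
      then show ?thesis by (simp only: powr_powr [symmetric] powr_realpow)
    qed
    also have "\<dots> \<le> (1 / 8) ^ N" using c by (intro power_mono) auto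
    finally show ?thesis .
  qed
  have "{h. \<exists>S K. S \<subseteq> {1..N} \<and> card S = k \<and> K \<subseteq> {1..N} \<and>
      \<epsilon> * real N \<le> real (card K) \<and> (\<forall>j\<in>K. \<forall>l\<in>{1..d}. h (j, l) \<notin> S)} = {h. \<exists>x\<in>?A. ?P x h}"
    by auto
  then have "measure_pmf.prob ?q {h. \<exists>S K. S \<subseteq> {1..N} \<and> card S = k \<and> K \<subseteq> {1..N} \<and>
      \<epsilon> * real N \<le> real (card K) \<and> (\<forall>j\<in>K. \<forall>l\<in>{1..d}. h (j, l) \<notin> S)} \<le> real (card ?A) * (1 / 8) ^ N"
    using prob_Bex_le[OF fin one] by (simp only:)
  also have "\<dots> \<le> 4 ^ N * (1 / 8) ^ N" using cA by (intro mult_right_mono) auto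
  also have "\<dots> = (4 * (1 / 8)) ^ N" by (rule power_mult_distrib [symmetric])
  also have "\<dots> = (1 / 2) ^ N" by simp
  finally show ?thesis .
qed

lemma prob_many_overloaded:
  assumes "N > 0" "n * p \<le> N" "p > 0" and b: "real (n * p) / real N * real d \<le> real p / 2 + 1"
    and c: "exp (real p / 2 + 1) / 2 ^ p \<le> (1 / 4) ^ 20"
  shows "measure_pmf.prob (choices N N d)
      {h. 1 / 20 * real N \<le> real (card {j\<in>{1..N}. p < card {l\<in>{1..d}. block p (h (j, l)) < n}})} \<le> (1 / 2) ^ N"
proof -
  let ?q = "choices N N d"
  let ?A = "{K \<in> Pow {1..N}. N \<le> 20 * card K}"
  let ?P = "\<lambda>K h. \<forall>j\<in>K. p < card {l\<in>{1..d}. block p (h (j, l)) < n}"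
  have "card ?A \<le> card (Pow {1..N})" by (intro card_mono) auto
  also have "\<dots> = 2 ^ N" by (simp add: card_Pow)
  finally have "real (card ?A) \<le> real (2 ^ N)" by (rule of_nat_mono)
  then have cA: "real (card ?A) \<le> 2 ^ N" by simp
  have one: "measure_pmf.prob ?q {h. ?P K h} \<le> (1 / 4) ^ N" if K: "K \<in> ?A" for K
  proof -
    let ?x = "real (n * p) / real N"
    have "(1 + ?x) ^ d \<le> exp ?x ^ d" using exp_ge_add_one_self by (intro power_mono) auto
    also have "\<dots> = exp (?x * real d)" by (simp only: exp_of_nat_mult [symmetric] mult.commute)
    also have "\<dots> \<le> exp (real p / 2 + 1)" using b by simp
    finally have "(1 + ?x) ^ d / 2 ^ p \<le> exp (real p / 2 + 1) / 2 ^ p" by (intro divide_right_mono) auto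
    also note c
    finally have base: "(1 + ?x) ^ d / 2 ^ p \<le> (1 / 4) ^ 20" .
    have "measure_pmf.prob ?q {h. ?P K h} \<le> ((1 + ?x) ^ d / 2 ^ p) ^ card K"
      using K assms by (intro prob_overloaded) auto
    also have "\<dots> \<le> ((1 / 4) ^ 20) ^ card K" using base by (intro power_mono) auto
    also have "\<dots> = (1 / 4) ^ (20 * card K)" by (simp only: power_mult)
    also have "\<dots> \<le> (1 / 4) ^ N" using K by (intro power_decreasing) auto
    finally show ?thesis .
  qed
  have "measure_pmf.prob ?q {h. 1 / 20 * real N \<le> real (card {j\<in>{1..N}. p < card {l\<in>{1..d}. block p (h (j, l)) < n}})}
      \<le> measure_pmf.prob ?q {h. \<exists>K\<in>?A. ?P K h}"
  proof (intro measure_pmf.finite_measure_mono subsetI)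
    fix h assume "h \<in> {h. 1 / 20 * real N \<le> real (card {j\<in>{1..N}. p < card {l\<in>{1..d}. block p (h (j, l)) < n}})}"
    then have "N \<le> 20 * card {j\<in>{1..N}. p < card {l\<in>{1..d}. block p (h (j, l)) < n}}" by simp
    then have "{j\<in>{1..N}. p < card {l\<in>{1..d}. block p (h (j, l)) < n}} \<in> ?A" by blast
    moreover have "?P {j\<in>{1..N}. p < card {l\<in>{1..d}. block p (h (j, l)) < n}} h" by simp
    ultimately have "\<exists>K\<in>?A. ?P K h" by (rule bexI[rotated])
    then show "h \<in> {h. \<exists>K\<in>?A. ?P K h}" by (simp only: mem_Collect_eq)
  qed simp
  also have "\<dots> \<le> real (card ?A) * (1 / 4) ^ N" by (rule prob_Bex_le[OF _ one]) simp
  also have "\<dots> \<le> 2 ^ N * (1 / 4) ^ N" using cA by (intro mult_right_mono) auto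
  also have "\<dots> = (2 * (1 / 4)) ^ N" by (rule power_mult_distrib [symmetric])
  also have "\<dots> = (1 / 2) ^ N" by simp
  finally show ?thesis .
qed

lemma prob_many_colliding:
  assumes "N > 0" "p > 0"
  shows "measure_pmf.prob (choices N N d) {h. 1 / 20 * real N \<le> real (card {j\<in>{1..N}. colliding p N d h j})}
    \<le> 20 * (real d ^ 2 * real p + real d ^ 4 * real p ^ 2) / real N"
proof -
  let ?b = "real d ^ 2 * (real p / real N) + real N * real d ^ 4 * (real p / real N) ^ 2"
  have "measure_pmf.prob (choices N N d) {h. 1 / 20 * real N \<le> real (card {j\<in>{1..N}. colliding p N d h j})}
      \<le> real (card {1..N}) * ?b / (1 / 20 * real N)"
    using assms by (intro prob_count_ge_le prob_colliding) auto
  also have "\<dots> = 20 * (real d ^ 2 * real p + real d ^ 4 * real p ^ 2) / real N"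
    using assms(1) by (simp add: field_simps power2_eq_square)
  finally show ?thesis .
qed

lemma good_graph_prob:
  fixes \<alpha> K0 \<epsilon> \<rho> :: real and d p a N n t k :: nat
  defines "K0 \<equiv> 3 * 2 ^ d * real (d * p) powr 1.1"
  assumes p: "prime p" and a: "a \<le> p" and d: "d > 0" and N0: "N > 0"
    and \<rho>: "0 < \<rho>" "\<rho> < 1" and \<epsilon>: "\<epsilon> > 0"
    and \<alpha>: "\<alpha> > 0" "real (d * p) * \<alpha> \<le> 1" "K0 * \<alpha> powr 0.1 \<le> 1 / 2"
    and n: "n * p \<le> N" "\<rho> * real N \<le> real (n * a)" "real (n * p) / real N * real d \<le> real p / 2 + 1"
    and t: "t \<ge> 1" "d \<le> t" "real (6 * t) \<le> \<alpha> * real N"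
    and k: "k \<le> N" "\<rho> / 2 \<le> real k / real N"
    and c1: "(1 - \<rho> / 2) powr (real d * \<epsilon>) \<le> 1 / 8"
    and c2: "exp (real p / 2 + 1) / 2 ^ p \<le> (1 / 4) ^ 20"
    and x: "x \<ge> 0"
  shows "1 - (2 * (1 / 2) ^ N + 20 * (real d ^ 2 * real p + real d ^ 4 * real p ^ 2) / real N + 4 * K0 * real N powr - 0.1)
    \<le> measure_pmf.prob (random_bipartite N N d)
         {E. disperser N N E k ((1 - x - \<epsilon>) * real N) \<and>
             lasserre_value N N E \<rho> t \<le> ereal (real N - 0.9 * real N * ((real p - real a) / (real p)\<^sup>2))}"
proof -
  let ?q = "choices N N d"
  let ?good = "\<lambda>E. disperser N N E k ((1 - x - \<epsilon>) * real N) \<and>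
             lasserre_value N N E \<rho> t \<le> ereal (real N - 0.9 * real N * ((real p - real a) / (real p)\<^sup>2))"
  define A1 where "A1 = {h. \<exists>S K. S \<subseteq> {1..N} \<and> card S = k \<and> K \<subseteq> {1..N} \<and>
      \<epsilon> * real N \<le> real (card K) \<and> (\<forall>j\<in>K. \<forall>l\<in>{1..d}. h (j, l) \<notin> S)}"
  define A2 where "A2 = {h. 1 / 20 * real N \<le> real (card {j\<in>{1..N}. p < card {l\<in>{1..d}. block p (h (j, l)) < n}})}"
  define A3 where "A3 = {h. 1 / 20 * real N \<le> real (card {j\<in>{1..N}. colliding p N d h j})}"
  define A4 where "A4 = {h. \<exists>K. K \<subseteq> {1..N} \<and> K \<noteq> {} \<and> real (card K) \<le> \<alpha> * real N \<and> crowded p d h K}"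
  have p0: "p > 0" using p by (simp add: prime_gt_0_nat)
  have b1: "measure_pmf.prob ?q A1 \<le> (1 / 2) ^ N"
    unfolding A1_def by (rule prob_exists_undispersed[OF N0 \<rho> \<epsilon> k c1])
  have b2: "measure_pmf.prob ?q A2 \<le> (1 / 2) ^ N"
    unfolding A2_def by (rule prob_many_overloaded[OF N0 n(1) p0 n(3) c2])
  have b3: "measure_pmf.prob ?q A3 \<le> 20 * (real d ^ 2 * real p + real d ^ 4 * real p ^ 2) / real N"
    unfolding A3_def by (rule prob_many_colliding[OF N0 p0])
  have b4: "measure_pmf.prob ?q A4 \<le> 4 * K0 * real N powr - 0.1"
    unfolding A4_def K0_def by (rule prob_exists_crowded[OF N0 p0 d \<alpha>(1,2) \<alpha>(3)[unfolded K0_def]])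
  have good: "?good (edges N d h)" if h: "h \<in> set_pmf ?q" and nA: "h \<notin> A1" "h \<notin> A2" "h \<notin> A3" "h \<notin> A4" for h
  proof
    have range: "h (j, l) \<in> {1..N}" if "j \<in> {1..N}" "l \<in> {1..d}" for j l
      using h N0 that by (auto simp: choices_def set_Pi_pmf PiE_dflt_def)
    show "disperser N N (edges N d h) k ((1 - x - \<epsilon>) * real N)"
      using nA(1) unfolding A1_def by (intro disperser_edges range x) blast+
    show "lasserre_value N N (edges N d h) \<rho> t \<le> ereal (real N - 0.9 * real N * ((real p - real a) / (real p)\<^sup>2))"
    proof (rule lasserre_value_edges[OF p a n(1,2) t(1,2)])
      show "h (j, l) \<in> {1..N}" if "j \<in> {1..N}" "l \<in> {1..d}" for j l using that by (rule range)
      fix K assume K: "K \<subseteq> {1..N}" "K \<noteq> {}" "card K \<le> 6 * t"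
      have "real (card K) \<le> \<alpha> * real N" using of_nat_mono[OF K(3), where 'a = real] t(3) by linarith
      then show "\<not> crowded p d h K" using nA(4) K unfolding A4_def by blast
    qed (use nA in \<open>auto simp: A2_def A3_def\<close>)
  qed
  have "measure_pmf.prob ?q {h. \<not> ?good (edges N d h)} \<le> measure_pmf.prob ?q (A1 \<union> A2 \<union> A3 \<union> A4)"
    using good by (intro measure_pmf.finite_measure_mono_AE) (auto simp: AE_measure_pmf_iff)
  also have "\<dots> \<le> measure_pmf.prob ?q A1 + measure_pmf.prob ?q A2 + measure_pmf.prob ?q A3 + measure_pmf.prob ?q A4"
    by (intro order_trans[OF measure_Un_le] add_mono order_refl) auto
  also have "\<dots> \<le> 2 * (1 / 2) ^ N + 20 * (real d ^ 2 * real p + real d ^ 4 * real p ^ 2) / real N + 4 * K0 * real N powr - 0.1"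
    using b1 b2 b3 b4 by linarith
  finally have "measure_pmf.prob ?q {h. \<not> ?good (edges N d h)}
      \<le> 2 * (1 / 2) ^ N + 20 * (real d ^ 2 * real p + real d ^ 4 * real p ^ 2) / real N + 4 * K0 * real N powr - 0.1" .
  moreover have "measure_pmf.prob ?q {h. ?good (edges N d h)} = 1 - measure_pmf.prob ?q {h. \<not> ?good (edges N d h)}"
    using measure_pmf.prob_compl[of "{h. \<not> ?good (edges N d h)}" ?q] by (simp add: Compl_eq_Diff_UNIV [symmetric] Collect_neg_eq [symmetric])
  moreover have "measure_pmf.prob (random_bipartite N N d) {E. ?good E} = measure_pmf.prob ?q {h. ?good (edges N d h)}"
    unfolding random_bipartite_eq by (simp add: vimage_def)
  ultimately show ?thesis by linarith
qed

lemma good_graph_whp: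
  fixes \<epsilon> \<rho> :: real and d p a :: nat
  assumes p: "prime p" and a: "a \<le> p" "\<rho> * real p < real a" and d: "d > 0" "2 * \<rho> * real d \<le> real a"
    and \<rho>: "0 < \<rho>" "\<rho> < 1" and \<epsilon>: "\<epsilon> > 0"
    and c1: "(1 - \<rho> / 2) powr (real d * \<epsilon>) \<le> 1 / 8"
    and c2: "exp (real p / 2 + 1) / 2 ^ p \<le> (1 / 4) ^ 20"
  obtains c' where "c' > 0"
    "(\<lambda>N. measure_pmf.prob (random_bipartite N N d)
         {E. disperser N N E (nat \<lfloor>\<rho> * real N\<rfloor>) ((1 - (1 - \<rho>) ^ d - \<epsilon>) * real N) \<and>
             lasserre_value N N E \<rho> (nat \<lfloor>c' * real N\<rfloor>)
               \<le> ereal (real N - 0.9 * real N * ((real p - real a) / (real p)\<^sup>2))}) \<longlonglongrightarrow> 1"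
proof -
  define K0 where "K0 = 3 * 2 ^ d * real (d * p) powr 1.1"
  define \<alpha> where "\<alpha> = min (1 / real (d * p)) ((1 / (2 * K0)) powr 10)"
  define c' where "c' = \<alpha> / 6"
  have p0: "p > 0" using p by (simp add: prime_gt_0_nat)
  have K0: "K0 > 0" using p0 d by (simp add: K0_def)
  have \<alpha>1: "\<alpha> > 0" using p0 d K0 by (simp add: \<alpha>_def)
  have "real (d * p) * \<alpha> \<le> real (d * p) * (1 / real (d * p))" by (intro mult_left_mono) (auto simp: \<alpha>_def)
  then have \<alpha>2: "real (d * p) * \<alpha> \<le> 1" using p0 d by simp
  have "\<alpha> powr 0.1 \<le> ((1 / (2 * K0)) powr 10) powr 0.1"
    using \<alpha>1 by (intro powr_mono2) (auto simp: \<alpha>_def)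
  also have "\<dots> = 1 / (2 * K0)" using K0 by (simp only: powr_powr) simp
  finally have "K0 * \<alpha> powr 0.1 \<le> K0 * (1 / (2 * K0))" using K0 by (intro mult_left_mono) auto
  then have \<alpha>3: "K0 * \<alpha> powr 0.1 \<le> 1 / 2" using K0 by simp
  have a0: "real a > 0" using a(2) \<rho> p0 by (smt (verit) mult_pos_pos of_nat_0_less_iff)
  have c'0: "c' > 0" using \<alpha>1 by (simp add: c'_def)
  define B where "B = (\<lambda>N::nat. 2 * (1 / 2) ^ N + 20 * (real d ^ 2 * real p + real d ^ 4 * real p ^ 2) / real N + 4 * K0 * real N powr - 0.1)"
  let ?f = "\<lambda>N. measure_pmf.prob (random_bipartite N N d)
         {E. disperser N N E (nat \<lfloor>\<rho> * real N\<rfloor>) ((1 - (1 - \<rho>) ^ d - \<epsilon>) * real N) \<and>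
             lasserre_value N N E \<rho> (nat \<lfloor>c' * real N\<rfloor>)
               \<le> ereal (real N - 0.9 * real N * ((real p - real a) / (real p)\<^sup>2))}"
  define N0 where "N0 = Max {2 / \<rho>, real p / (1 - \<rho> * real p / real a), real (p * d), real d / c', 1}"
  have bound: "1 - B N \<le> ?f N" if N: "real N \<ge> N0" for N
  proof -
    have N1: "real N \<ge> 2 / \<rho>" "real N \<ge> real p / (1 - \<rho> * real p / real a)" "real N \<ge> real (p * d)"
      "real N \<ge> real d / c'" "real N \<ge> 1"
      using N by (auto simp: N0_def)
    have Npos: "N > 0" using N1(5) by simp
    define n where "n = nat \<lceil>\<rho> * real N / real a\<rceil>"
    have n1: "\<rho> * real N / real a \<le> real n" unfolding n_def by linarith
    have "0 \<le> \<rho> * real N / real a" using \<rho> by simp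
    then have n2: "real n \<le> \<rho> * real N / real a + 1" unfolding n_def by linarith
    have np: "real (n * p) \<le> \<rho> * real p / real a * real N + real p"
      using mult_right_mono[OF n2, of "real p"] by (simp add: field_simps)
    have gap: "1 - \<rho> * real p / real a > 0" using a(2) a0 by simp
    have "real p \<le> real N * (1 - \<rho> * real p / real a)" using N1(2) gap by (simp add: pos_divide_le_eq)
    then have "real (n * p) \<le> real N" using np by (simp add: right_diff_distrib mult.commute)
    then have i1: "n * p \<le> N" by (simp only: of_nat_le_iff)
    have i2: "\<rho> * real N \<le> real (n * a)" using n1 a0 by (simp add: pos_divide_le_eq)
    have i3: "real (n * p) / real N * real d \<le> real p / 2 + 1"
    proof -
      have "real (n * p) * real d \<le> (\<rho> * real p / real a * real N + real p) * real d"
        using np by (intro mult_right_mono) auto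
      also have "\<dots> = (2 * \<rho> * real d) * (real p * real N / (2 * real a)) + real (p * d)" by (simp add: field_simps)
      also have "\<dots> \<le> real a * (real p * real N / (2 * real a)) + real N"
        using d(2) N1(3) a0 by (intro add_mono mult_right_mono) auto
      also have "\<dots> = (real p / 2 + 1) * real N" using a0 by (simp add: field_simps)
      finally show ?thesis using Npos by (simp add: field_simps)
    qed
    define t where "t = nat \<lfloor>c' * real N\<rfloor>"
    have "real d \<le> c' * real N" using N1(4) c'0 by (simp add: pos_divide_le_eq mult.commute)
    then have t1: "d \<le> t" unfolding t_def by (simp add: le_nat_floor)
    have t2: "t \<ge> 1" using t1 d(1) by simp
    have "real t \<le> c' * real N" unfolding t_def using c'0 by (intro of_nat_floor) simp
    then have t3: "real (6 * t) \<le> \<alpha> * real N" by (simp add: c'_def)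
    define k where "k = nat \<lfloor>\<rho> * real N\<rfloor>"
    have "real k \<le> \<rho> * real N" unfolding k_def using \<rho> by (intro of_nat_floor) simp
    also have "\<dots> \<le> real N" using \<rho> by (simp add: mult_left_le_one_le)
    finally have k1: "k \<le> N" by simp
    have "2 \<le> \<rho> * real N" using N1(1) \<rho> by (simp add: pos_divide_le_eq mult.commute)
    moreover have "real k \<ge> \<rho> * real N - 1" unfolding k_def by linarith
    ultimately have "\<rho> * real N / 2 \<le> real k" by linarith
    then have k2: "\<rho> / 2 \<le> real k / real N" using Npos by (simp add: pos_le_divide_eq)
    have "1 - B N \<le> measure_pmf.prob (random_bipartite N N d)
         {E. disperser N N E k ((1 - (1 - \<rho>) ^ d - \<epsilon>) * real N) \<and>
             lasserre_value N N E \<rho> t \<le> ereal (real N - 0.9 * real N * ((real p - real a) / (real p)\<^sup>2))}"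
      unfolding B_def K0_def
      using \<rho> by (intro good_graph_prob[OF p a(1) d(1) Npos \<rho> \<epsilon> \<alpha>1 \<alpha>2 \<alpha>3[unfolded K0_def] i1 i2 i3 t2 t1 t3 k1 k2 c1 c2]) simp
    then show ?thesis by (simp only: k_def t_def)
  qed
  have "\<forall>\<^sub>F N in sequentially. real N \<ge> N0"
    using filterlim_real_sequentially by (auto simp: filterlim_at_top)
  then have lower: "\<forall>\<^sub>F N in sequentially. 1 - B N \<le> ?f N"
    by eventually_elim (rule bound)
  have "B \<longlonglongrightarrow> 2 * 0 + 0 + 4 * K0 * 0"
    unfolding B_def
  proof (intro tendsto_add tendsto_mult tendsto_const)
    show "(\<lambda>N. (1 / 2 :: real) ^ N) \<longlonglongrightarrow> 0" by (rule LIMSEQ_realpow_zero) auto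
    show "(\<lambda>N. 20 * (real d ^ 2 * real p + real d ^ 4 * real p ^ 2) / real N) \<longlonglongrightarrow> 0"
      by (rule lim_const_over_n)
    show "(\<lambda>N. real N powr - 0.1) \<longlonglongrightarrow> 0"
      by (rule tendsto_neg_powr[OF _ filterlim_real_sequentially]) simp
  qed
  then have "(\<lambda>N. 1 - B N) \<longlonglongrightarrow> 1 - 0" by (intro tendsto_diff tendsto_const) simp
  then have "?f \<longlonglongrightarrow> 1"
    by (intro tendsto_sandwich[OF lower _ _ tendsto_const]) auto
  then show ?thesis using that[OF c'0] by blast
qed

lemma parameters_exist:
  fixes \<epsilon> \<rho> :: real and D :: nat
  assumes \<rho>: "0 < \<rho>" "\<rho> < 1" and \<epsilon>: "\<epsilon> > 0"
  obtains p a d :: nat where "prime p" "a \<le> p" "\<rho> * real p < real a" "d > D" "2 * \<rho> * real d \<le> real a"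
    "(1 - \<rho> / 2) powr (real d * \<epsilon>) \<le> 1 / 8" "exp (real p / 2 + 1) / 2 ^ p \<le> (1 / 4) ^ 20"
    "1 / 10 * ((1 - \<rho>) / (real d * \<rho> + 1 - \<rho>)) \<le> 0.9 * ((real p - real a) / (real p)\<^sup>2)"
proof -
  define \<sigma> where "\<sigma> = (1 + \<rho>) / 2"
  have \<sigma>: "1 / 2 < \<sigma>" "\<sigma> < 1" "\<rho> < \<sigma>" using \<rho> by (auto simp: \<sigma>_def)
  have "(\<lambda>d. ((1 - \<rho> / 2) powr \<epsilon>) ^ d) \<longlonglongrightarrow> 0"
  proof (rule LIMSEQ_realpow_zero)
    show "(1 - \<rho> / 2) powr \<epsilon> < 1" using \<rho> \<epsilon> powr_less_mono2[of \<epsilon> "1 - \<rho> / 2" 1] by simp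
  qed simp
  then have "\<forall>\<^sub>F d in sequentially. ((1 - \<rho> / 2) powr \<epsilon>) ^ d < 1 / 8"
    by (rule order_tendstoD) simp
  then obtain D1 where D1: "\<And>d. d \<ge> D1 \<Longrightarrow> ((1 - \<rho> / 2) powr \<epsilon>) ^ d < 1 / 8"
    by (auto simp: eventually_sequentially)
  have "exp (1 / 2 :: real) ^ 2 = exp 1" by (simp add: exp_double [symmetric])
  also have "\<dots> < 2 ^ 2" using exp_le by simp
  finally have "exp (1 / 2 :: real) < 2" by (rule power_less_imp_less_base) simp
  then have lim: "(\<lambda>p. exp 1 * (exp (1 / 2 :: real) / 2) ^ p) \<longlonglongrightarrow> exp 1 * 0"
    by (intro tendsto_mult tendsto_const LIMSEQ_realpow_zero) auto
  have "\<forall>\<^sub>F p in sequentially. exp 1 * (exp (1 / 2 :: real) / 2) ^ p < (1 / 4) ^ 20"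
    by (rule order_tendstoD(2)[OF lim]) simp
  then obtain P1 where P1: "\<And>p. p \<ge> P1 \<Longrightarrow> exp 1 * (exp (1 / 2 :: real) / 2) ^ p < (1 / 4) ^ 20"
    by (auto simp: eventually_sequentially)
  define P where "P = Max {real P1, 36 + 9 / (1 - \<sigma>), 4 * (real D1 + real D + 2), 1 / (1 - \<sigma>)}"
  obtain p where p: "prime p" "p > nat \<lceil>P\<rceil>" using bigger_prime by blast
  have "real p \<ge> P" using p(2) by linarith
  then have pP: "real p \<ge> real P1" "real p \<ge> 36 + 9 / (1 - \<sigma>)" "real p \<ge> 4 * (real D1 + real D + 2)" "real p \<ge> 1 / (1 - \<sigma>)"
    by (auto simp: P_def)
  define a where "a = nat \<lceil>\<sigma> * real p\<rceil>"
  define d where "d = nat \<lfloor>real a / (2 * \<rho>)\<rfloor>"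
  have a1: "real a \<ge> \<sigma> * real p" unfolding a_def by linarith
  have "0 \<le> \<sigma> * real p" using \<sigma> by simp
  then have a2: "real a \<le> \<sigma> * real p + 1" unfolding a_def by linarith
  have "1 \<le> (1 - \<sigma>) * real p" using pP(4) \<sigma> by (simp add: pos_divide_le_eq mult.commute)
  then have "real a \<le> real p" using a2 by (simp add: left_diff_distrib)
  then have ap: "a \<le> p" by simp
  have p0: "real p > 0" using p(1) by (simp add: prime_gt_0_nat)
  have "\<rho> * real p < \<sigma> * real p" using \<sigma> p0 by simp
  then have rp: "\<rho> * real p < real a" using a1 by linarith
  have "real d \<le> real a / (2 * \<rho>)" unfolding d_def using \<rho> by (intro of_nat_floor) simp
  then have d2: "2 * \<rho> * real d \<le> real a" using \<rho> by (simp add: pos_le_divide_eq mult_ac)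
  have "real d \<ge> real a / (2 * \<rho>) - 1" unfolding d_def by linarith
  then have "(real a / (2 * \<rho>) - 1) * \<rho> \<le> real d * \<rho>" using \<rho> by (intro mult_right_mono) auto
  then have d3: "real a / 2 - \<rho> \<le> real d * \<rho>" using \<rho> by (simp add: left_diff_distrib)
  have "real p / 4 \<le> \<sigma> * real p / 2" using \<sigma> p0 by simp
  then have a4: "real p / 4 \<le> real a / 2" using a1 by linarith
  have "real d * \<rho> \<le> real d" using \<rho> by (simp add: mult_left_le)
  then have "real d \<ge> real p / 4 - 1" using d3 a4 \<rho> by linarith
  then have "real d > real D" "real d \<ge> real D1" using pP(3) by simp_all
  then have dD: "d > D" "d \<ge> D1" by simp_all
  have "(1 - \<rho> / 2) powr (real d * \<epsilon>) = ((1 - \<rho> / 2) powr \<epsilon>) ^ d"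
  proof -
    have "(1 - \<rho> / 2) powr \<epsilon> > 0" using \<rho> by simp
    then show ?thesis by (simp only: mult.commute[of "real d"] powr_powr [symmetric] powr_realpow)
  qed
  then have c1: "(1 - \<rho> / 2) powr (real d * \<epsilon>) \<le> 1 / 8" using D1[OF dD(2)] by simp
  have "exp (real p / 2 + 1) / 2 ^ p = exp 1 * (exp (1 / 2) / 2) ^ p"
    by (simp add: exp_add power_divide exp_of_nat_mult [symmetric])
  then have c2: "exp (real p / 2 + 1) / 2 ^ p \<le> (1 / 4) ^ 20" using P1[of p] pP(1) by simp
  define q where "q = 1 - \<sigma>"
  have q: "q > 0" using \<sigma> by (simp add: q_def)
  have X: "real p - real a \<ge> q * real p - 1" using a2 by (simp add: q_def left_diff_distrib)
  have Y: "real d * \<rho> + 1 - \<rho> \<ge> real p / 4 - 1" using d3 a4 \<rho> by linarith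
  have Y0: "real p / 4 - 1 > 0"
  proof -
    have "9 / (1 - \<sigma>) > 0" using \<sigma> by simp
    then show ?thesis using pP(2) by linarith
  qed
  have qp: "q * real p \<ge> 36 * q + 9"
    using mult_left_mono[OF pP(2), of q] q by (simp add: q_def [symmetric] distrib_left)
  have "2 * q * (real p)\<^sup>2 \<le> 9 * ((q * real p - 1) * (real p / 4 - 1))"
  proof -
    have le: "real p * (36 * q + 9) \<le> real p * (q * real p)" using qp p0 by (intro mult_left_mono) auto
    have eq: "9 * ((q * real p - 1) * (real p / 4 - 1))
        = 2 * q * (real p)\<^sup>2 + (real p * (q * real p) - real p * (36 * q + 9)) / 4 + 9"
      by (simp add: field_simps power2_eq_square)
    have "u \<le> u + (w - v) / 4 + 9" if "v \<le> w" for u v w :: real using that by simp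
    from this[OF le] show ?thesis unfolding eq .
  qed
  also have "\<dots> \<le> 9 * ((real p - real a) * (real d * \<rho> + 1 - \<rho>))"
    using X Y Y0 qp q by (intro mult_left_mono mult_mono) auto
  also have "2 * q = 1 - \<rho>" by (simp add: q_def \<sigma>_def field_simps)
  finally have le: "(1 - \<rho>) * (real p)\<^sup>2 \<le> 9 * ((real p - real a) * (real d * \<rho> + 1 - \<rho>))" .
  have c3: "1 / 10 * ((1 - \<rho>) / (real d * \<rho> + 1 - \<rho>)) \<le> 0.9 * ((real p - real a) / (real p)\<^sup>2)"
  proof -
    define z where "z = real d * \<rho> + 1 - \<rho>"
    have "z > 0" using Y Y0 by (simp add: z_def)
    then have "(1 - \<rho>) / z \<le> 9 * (real p - real a) / (real p)\<^sup>2"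
      using le p0 unfolding z_def [symmetric] by (simp add: pos_divide_le_eq pos_le_divide_eq mult_ac)
    then show ?thesis unfolding z_def [symmetric] by simp
  qed
  show ?thesis by (rule that[OF p(1) ap rp dD(1) d2 c1 c2 c3])
qed

theorem theorem8:
  shows "\<exists>C0::real. C0 \<ge> 1/10 \<and>
    (\<forall>(\<epsilon>::real) (\<rho>::real). \<epsilon> > 0 \<and> 0 < \<rho> \<and> \<rho> < 1 \<longrightarrow>
      infinite {d::nat. d > 0 \<and>
        (\<exists>(c::real) (c'::real). c > 0 \<and> c' > 0 \<and>
          (\<lambda>N::nat.
             let M = nat \<lfloor>c * real N\<rfloor> in
             measure_pmf.prob (random_bipartite N M d)
               {E. disperser N M E (nat \<lfloor>\<rho> * real N\<rfloor>)
                     ((1 - (1 - \<rho>) ^ d - \<epsilon>) * real M) \<and>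
                   lasserre_value N M E \<rho> (nat \<lfloor>c' * real N\<rfloor>)
                     \<le> ereal ((1 - C0 * ((1 - \<rho>) / (real d * \<rho> + 1 - \<rho>))) * real M)})
          \<longlonglongrightarrow> 1)})"
proof (intro exI[of _ "1 / 10"] conjI allI impI order_refl)
  fix \<epsilon> \<rho> :: real
  assume "\<epsilon> > 0 \<and> 0 < \<rho> \<and> \<rho> < 1"
  then have \<rho>: "0 < \<rho>" "\<rho> < 1" and \<epsilon>: "\<epsilon> > 0" by auto
  let ?v = "\<lambda>d::nat. (1 - \<rho>) / (real d * \<rho> + 1 - \<rho>)"
  let ?f = "\<lambda>c c' d N. let M = nat \<lfloor>c * real N\<rfloor> in
             measure_pmf.prob (random_bipartite N M d)
               {E. disperser N M E (nat \<lfloor>\<rho> * real N\<rfloor>)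
                     ((1 - (1 - \<rho>) ^ d - \<epsilon>) * real M) \<and>
                   lasserre_value N M E \<rho> (nat \<lfloor>c' * real N\<rfloor>)
                     \<le> ereal ((1 - 1 / 10 * ?v d) * real M)}"
  show "infinite {d::nat. d > 0 \<and> (\<exists>(c::real) (c'::real). c > 0 \<and> c' > 0 \<and> ?f c c' d \<longlonglongrightarrow> 1)}"
    unfolding infinite_nat_iff_unbounded
  proof
    fix D :: nat
    obtain p a d :: nat where pad: "prime p" "a \<le> p" "\<rho> * real p < real a" "d > D" "2 * \<rho> * real d \<le> real a"
      "(1 - \<rho> / 2) powr (real d * \<epsilon>) \<le> 1 / 8" "exp (real p / 2 + 1) / 2 ^ p \<le> (1 / 4) ^ 20"
      and v: "1 / 10 * ?v d \<le> 0.9 * ((real p - real a) / (real p)\<^sup>2)"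
      by (rule parameters_exist[OF \<rho> \<epsilon>, of D])
    have d0: "d > 0" using pad(4) by simp
    let ?w = "\<lambda>N. real N - 0.9 * real N * ((real p - real a) / (real p)\<^sup>2)"
    obtain c' where c': "c' > 0" and lim: "(\<lambda>N. measure_pmf.prob (random_bipartite N N d)
         {E. disperser N N E (nat \<lfloor>\<rho> * real N\<rfloor>) ((1 - (1 - \<rho>) ^ d - \<epsilon>) * real N) \<and>
             lasserre_value N N E \<rho> (nat \<lfloor>c' * real N\<rfloor>) \<le> ereal (?w N)}) \<longlonglongrightarrow> 1"
      by (rule good_graph_whp[OF pad(1-3) d0 pad(5) \<rho> \<epsilon> pad(6,7)])
    have w: "?w N \<le> (1 - 1 / 10 * ?v d) * real N" for N
      using mult_left_mono[OF v, of "real N"] by (simp add: algebra_simps)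
    have "?f 1 c' d \<longlonglongrightarrow> 1"
    proof (rule tendsto_sandwich[OF _ _ lim tendsto_const])
      show "\<forall>\<^sub>F N in sequentially. measure_pmf.prob (random_bipartite N N d)
         {E. disperser N N E (nat \<lfloor>\<rho> * real N\<rfloor>) ((1 - (1 - \<rho>) ^ d - \<epsilon>) * real N) \<and>
             lasserre_value N N E \<rho> (nat \<lfloor>c' * real N\<rfloor>) \<le> ereal (?w N)} \<le> ?f 1 c' d N"
      proof (intro always_eventually allI)
        fix N
        have le: "lv \<le> ereal (?w N) \<Longrightarrow> lv \<le> ereal ((1 - 1 / 10 * ?v d) * real N)" for lv
          using w[of N] by (meson ereal_less_eq(3) order_trans)
        show "measure_pmf.prob (random_bipartite N N d)
         {E. disperser N N E (nat \<lfloor>\<rho> * real N\<rfloor>) ((1 - (1 - \<rho>) ^ d - \<epsilon>) * real N) \<and>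
             lasserre_value N N E \<rho> (nat \<lfloor>c' * real N\<rfloor>) \<le> ereal (?w N)} \<le> ?f 1 c' d N"
          unfolding Let_def mult_1 floor_of_nat nat_int
          by (rule measure_pmf.finite_measure_mono, rule Collect_mono, rule impI, erule conjE, rule conjI)
            (assumption, erule le, simp)
      qed
      show "\<forall>\<^sub>F N in sequentially. ?f 1 c' d N \<le> 1"
        by (intro always_eventually allI) (simp add: Let_def)
    qed
    then have "d \<in> {d::nat. d > 0 \<and> (\<exists>(c::real) (c'::real). c > 0 \<and> c' > 0 \<and> ?f c c' d \<longlonglongrightarrow> 1)}"
      by (intro CollectI conjI exI[of _ "1::real"] exI[of _ c'] d0 c' zero_less_one)
    with pad(4) show "\<exists>d'>D. d' \<in> {d::nat. d > 0 \<and> (\<exists>(c::real) (c'::real). c > 0 \<and> c' > 0 \<and> ?f c c' d \<longlonglongrightarrow> 1)}"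
      by (intro exI[of _ d] conjI)
  qed
qed

end
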